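(* Let $m$ be a positive even integer and let $A>0$ and $\delta>0$ be real numbers. Then there exist infinitely many primes $p_0$ such that $L_m(p_0^{\alpha})+L_m^{(2)}(p_0^{\alpha})>p_0^{\alpha}+A\,p_0^{\alpha-\delta}$ for all positive integers $\alpha$.
   Context: For $m,n\in\mathbb{N}$, the Schemmel totient function $L_m(n)$ is the number of integers $k\in\{1,\dots,n\}$ such that $\gcd(k+s,n)=1$ for all $s\in\{0,1,\dots,m-1\}$; by convention $L_m(0)=0$. Equivalently, $L_m(1)=1$, and for $n>1$ with $n=\prod_{i=1}^r p_i^{\alpha_i}$, $L_m(n)=0$ if the smallest prime factor of $n$ is $\le m$, and $L_m(n)=\prod_{i} p_i^{\alpha_i-1}(p_i-m)$ otherwise. $L_m^{(2)}=L_m\circ L_m$. *)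

theory Defs
  imports Complex_Main "HOL-Computational_Algebra.Primes"
begin

text \<open>For \<open>n = 0\<close> the set below is empty, so the convention \<open>L\<^sub>m(0) = 0\<close> is built in.\<close>

definition schemmel :: "nat \<Rightarrow> nat \<Rightarrow> nat" where
  "schemmel m n = card {k \<in> {1..n}. \<forall>s<m. coprime (k + s) n}"

end

theory Submission
  imports Defs "HOL-Analysis.Analysis" "HOL-Number_Theory.Number_Theory"
begin

text \<open>
  Since \<open>L\<^sub>m(p\<^sup>\<alpha>) = p\<^sup>\<alpha>\<^sup>-\<^sup>1 (p - m)\<close> and \<open>p\<close> does not divide \<open>p - m\<close>, the inequality for every \<open>\<alpha>\<close> follows from
  the single lower bound \<open>L\<^sub>m(p - m) > 2 m + 2 A p powr (1 - \<delta>)\<close>. If all prime factors of \<open>n\<close> exceed \<open>m\<close>,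
  then \<open>L\<^sub>m(n) / n\<close> is the product of the \<open>1 - m / q\<close> over the primes \<open>q\<close> dividing \<open>n\<close>, which decays more
  slowly than any negative power of \<open>n\<close>. So infinitely many primes \<open>p\<close> are needed for which \<open>p - m\<close> has no
  prime factor \<open>\<le> m\<close>. Full strength of Dirichlet's theorem can be avoided: primes dividing \<open>m\<close> (among
  them 2) cause no trouble, and for the others it is enough that the Legendre symbol of \<open>p\<close> is the
  negative of that of \<open>m\<close>. Infinitely many primes with prescribed Legendre symbols are obtained by
  Mertens' method with products of Legendre symbols, which are real characters; \<open>L(1) \<noteq> 0\<close> is proved
  with Lambert series, following Monsky.
\<close>

section \<open>Mangoldt sums and partial summation\<close>

text \<open>The substitution n = d k matches the pairs (n, d) with \<open>d dvd n\<close> to the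
  pairs (d, k) with d k at most N.\<close>

lemma sum_divisors_swap:
  fixes g :: "nat \<Rightarrow> nat \<Rightarrow> 'a :: comm_monoid_add"
  shows "(\<Sum>n=1..N. \<Sum>d | d dvd n. g d (n div d)) = (\<Sum>d=1..N. \<Sum>k=1..N div d. g d k)"
proof -
  have "(\<Sum>n=1..N. \<Sum>d | d dvd n. g d (n div d))
      = (\<Sum>(n, d)\<in>(SIGMA n:{1..N}. {d. d dvd n}). g d (n div d))"
    by (rule sum.Sigma) auto
  also have "\<dots> = (\<Sum>(d, k)\<in>(SIGMA d:{1..N}. {1..N div d}). g d k)"
  proof (rule sum.reindex_bij_witness[where i = "\<lambda>(d, k). (d * k, d)" and j = "\<lambda>(n, d). (d, n div d)"], goal_cases)
    case (2 a)
    then obtain n d where a: "a = (n, d)" "1 \<le> n" "n \<le> N" "d dvd n" by auto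
    then have "d \<le> n" "0 < d" "n div d > 0" "n div d \<le> N div d"
      by (auto intro: dvd_imp_le div_le_mono simp: dvd_pos_nat dvd_div_eq_0_iff)
    with a show ?case by auto
  next
    case (4 b)
    then obtain d k where b: "b = (d, k)" "1 \<le> d" "d \<le> N" "1 \<le> k" "k \<le> N div d" by auto
    then have "d * k \<le> N"
      by (metis div_times_less_eq_dividend mult.commute mult_le_mono1 order_trans)
    with b show ?case by auto
  qed auto
  also have "\<dots> = (\<Sum>d=1..N. \<Sum>k=1..N div d. g d k)"
    by (rule sum.Sigma[symmetric]) auto
  finally show ?thesis .
qed

text \<open>Summation by parts. The differences of \<open>a\<close> telescope to
  \<open>a M - a N\<close>, and together with the boundary terms at \<open>M\<close> and
  \<open>N\<close> this adds up to the factor 2.\<close>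

lemma abel_bound:
  fixes f a :: "nat \<Rightarrow> real"
  assumes B: "\<And>n. \<bar>\<Sum>k<n. f k\<bar> \<le> B"
    and nonneg: "\<And>k. M \<le> k \<Longrightarrow> 0 \<le> a k"
    and dec: "\<And>k. M \<le> k \<Longrightarrow> a (Suc k) \<le> a k"
    and "M \<le> N"
  shows "\<bar>\<Sum>k=M..<N. f k * a k\<bar> \<le> 2 * B * a M"
proof -
  define S where "S n = (\<Sum>k<n. f k)" for n
  have S: "\<bar>S n\<bar> \<le> B" for n using B by (simp add: S_def)
  have "B \<ge> 0" using S[of 0] by simp
  have "\<bar>(\<Sum>k=M..<N. f k * a k) - S N * a N + S M * a M\<bar> \<le> B * (a M - a N)"
    using \<open>M \<le> N\<close>
  proof (induction N rule: dec_induct)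
    case (step n)
    have "(\<Sum>k=M..<Suc n. f k * a k) - S (Suc n) * a (Suc n) + S M * a M
        = ((\<Sum>k=M..<n. f k * a k) - S n * a n + S M * a M) + S (Suc n) * (a n - a (Suc n))"
      using step by (simp add: S_def algebra_simps)
    moreover have "\<bar>S (Suc n) * (a n - a (Suc n))\<bar> \<le> B * (a n - a (Suc n))"
      using S[of "Suc n"] dec[of n] step by (simp add: abs_mult mult_right_mono)
    ultimately show ?case using step.IH by (simp add: algebra_simps)
  qed simp
  moreover have "\<bar>S N * a N\<bar> \<le> B * a N" "\<bar>S M * a M\<bar> \<le> B * a M"
    using S nonneg \<open>M \<le> N\<close> by (auto simp: abs_mult intro!: mult_right_mono)
  ultimately show ?thesis by (simp add: algebra_simps)
qed

lemma ln_Suc_diff_le: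
  assumes "n > 0"
  shows "ln (real (Suc n)) - ln (real n) \<le> 1 / real n"
proof -
  have "ln (real (Suc n)) - ln (real n) = ln (real (Suc n) / real n)"
    using assms by (subst ln_div) auto
  also have "real (Suc n) / real n = 1 + 1 / real n" using assms by (simp add: field_simps)
  also have "ln (1 + 1 / real n) \<le> 1 / real n" by (rule ln_add_one_self_le_self) simp
  finally show ?thesis .
qed

text \<open>The quotient ln x / x decreases once ln x is at least 1, hence from 3 on.\<close>

lemma ln_over_antimono:
  assumes "3 \<le> n"
  shows "ln (real (Suc n)) / real (Suc n) \<le> ln (real n) / real n"
proof -
  have "real n * (ln (real (Suc n)) - ln (real n)) \<le> 1"
    using ln_Suc_diff_le[of n] assms by (simp add: field_simps)
  moreover have "1 \<le> ln (real n)"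
    using assms exp_le by (subst ln_ge_iff) auto
  ultimately have "real n * ln (real (Suc n)) \<le> real (Suc n) * ln (real n)"
    by (simp add: algebra_simps)
  then show ?thesis using assms by (simp add: field_simps)
qed

section \<open>Estimates of Chebyshev and Mertens for Mangoldt sums\<close>

lemma sum_ln_eq_sum_mangoldt:
  "(\<Sum>n=1..N. ln (real n)) = (\<Sum>d=1..N. mangoldt d * real (N div d))"
proof -
  have "(\<Sum>n=1..N. ln (real n)) = (\<Sum>n=1..N. \<Sum>d | d dvd n. mangoldt d)"
    by (intro sum.cong refl) (simp add: mangoldt_sum)
  also have "\<dots> = (\<Sum>d=1..N. \<Sum>k=1..N div d. mangoldt d)"
    by (rule sum_divisors_swap)
  finally show ?thesis by (simp add: mult.commute)
qed

lemma ln_fact_eq_sum: "ln (fact N) = (\<Sum>n=1..N. ln (real n))"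
  by (induction N) (simp_all add: ln_mult_pos)

text \<open>One half of Mertens' first theorem: ln N! is at least N ln N - N, and replacing
  \<open>N div d\<close> by N / d only enlarges a sum with nonnegative coefficients.\<close>

lemma sum_mangoldt_div_ge:
  assumes "N > 0"
  shows "(\<Sum>d=1..N. mangoldt d / real d) \<ge> ln (real N) - 1"
proof -
  have "(\<Sum>n=1..N. ln (real n)) \<ge> real N * ln (real N) - real N"
    using assms
  proof (induction N rule: nat_induct_non_zero)
    case (Suc n)
    have "real n * (ln (real (Suc n)) - ln (real n)) \<le> 1"
      using ln_Suc_diff_le[of n] Suc by (simp add: field_simps)
    with Suc show ?case by (simp add: algebra_simps)
  qed simp
  also have "(\<Sum>n=1..N. ln (real n)) = (\<Sum>d=1..N. mangoldt d * real (N div d))"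
    by (rule sum_ln_eq_sum_mangoldt)
  also have "\<dots> \<le> (\<Sum>d=1..N. mangoldt d * (real N / real d))"
    by (intro sum_mono mult_left_mono of_nat_div_le_of_nat mangoldt_nonneg)
  also have "\<dots> = real N * (\<Sum>d=1..N. mangoldt d / real d)"
    by (simp add: sum_distrib_left mult_ac)
  finally have "real N * (ln (real N) - 1) \<le> real N * (\<Sum>d=1..N. mangoldt d / real d)"
    by (simp add: algebra_simps)
  then show ?thesis using assms by simp
qed

text \<open>Chebyshev's argument: the coefficient \<open>2 * n div d - 2 * (n div d)\<close> is
  nonnegative, and at least 1 for n < d \<le> 2 n. Weighting \<open>mangoldt\<close> by it gives the
  logarithm of the central binomial coefficient.\<close>

lemma sum_mangoldt_double:
  "(\<Sum>d=1..2*n. mangoldt d) - (\<Sum>d=1..n. mangoldt d) \<le> 2 * real n * ln 2"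
proof -
  have "(\<Sum>d=1..2*n. mangoldt d) - (\<Sum>d=1..n. mangoldt d) = (\<Sum>d\<in>{n<..2*n}. mangoldt d :: real)"
    by (subst sum_diff[symmetric]) (auto intro!: sum.cong)
  also have "\<dots> \<le> (\<Sum>d=1..2*n. mangoldt d * (real (2 * n div d) - 2 * real (n div d)))"
  proof -
    have nn: "real (2 * n div d) - 2 * real (n div d) \<ge> 0" for d
    proof -
      have "d * (n div d * 2) \<le> 2 * n" using times_div_less_eq_dividend[of d n] by linarith
      then have "d > 0 \<Longrightarrow> 2 * (n div d) \<le> 2 * n div d"
        by (subst less_eq_div_iff_mult_less_eq) (auto simp: mult_ac)
      then show ?thesis by (cases "d = 0") auto
    qed
    have "(\<Sum>d\<in>{n<..2*n}. mangoldt d) 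
        \<le> (\<Sum>d\<in>{n<..2*n}. mangoldt d * (real (2 * n div d) - 2 * real (n div d)))"
    proof (rule sum_mono)
      fix d assume d: "d \<in> {n<..2*n}"
      then have "n div d = 0" "2 * n div d \<ge> 1"
        by (auto simp: div_greater_zero_iff Suc_le_eq)
      then have "real (2 * n div d) - 2 * real (n div d) \<ge> 1" by simp
      then show "(mangoldt d :: real) \<le> mangoldt d * (real (2 * n div d) - 2 * real (n div d))"
        using mangoldt_nonneg[of d] by (metis mult.right_neutral mult_left_mono)
    qed
    also have "\<dots> \<le> (\<Sum>d=1..2*n. mangoldt d * (real (2 * n div d) - 2 * real (n div d)))"
      by (intro sum_mono2) (auto intro!: mult_nonneg_nonneg mangoldt_nonneg nn)
    finally show ?thesis .
  qed
  also have "\<dots> = (\<Sum>d=1..2*n. mangoldt d * real (2 * n div d)) 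
      - 2 * (\<Sum>d=1..2*n. mangoldt d * real (n div d))"
    by (simp add: right_diff_distrib sum_subtractf sum_distrib_left mult_ac)
  also have "(\<Sum>d=1..2*n. mangoldt d * real (n div d)) = (\<Sum>d=1..n. mangoldt d * real (n div d))"
    by (intro sum.mono_neutral_right) auto
  also have "(\<Sum>d=1..2*n. mangoldt d * real (2 * n div d)) - 2 * (\<Sum>d=1..n. mangoldt d * real (n div d))
      = ln (fact (2 * n)) - 2 * ln (fact n)"
    by (simp only: sum_ln_eq_sum_mangoldt[symmetric] ln_fact_eq_sum)
  also have "\<dots> = ln (real (2 * n choose n))"
    by (simp add: binomial_fact ln_div ln_mult_pos)
  also have "\<dots> \<le> ln (2 ^ (2 * n))"
  proof (subst ln_le_cancel_iff)
    have "(2 * n choose n) \<le> 2 ^ (2 * n)"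
      by (rule binomial_le_pow2)
    then show "real (2 * n choose n) \<le> 2 ^ (2 * n)"
      by (metis of_nat_le_iff of_nat_numeral of_nat_power)
  qed auto
  finally show ?thesis by (simp add: ln_realpow)
qed

text \<open>Repeated halving, with rounding up: the doubling bound gives at most 8 n \<le> 4 N + 4,
  and the slack in the constant 6 absorbs the 4 as soon as N \<ge> 2.\<close>

lemma sum_mangoldt_le: "(\<Sum>d=1..N. mangoldt d) \<le> 6 * real N"
proof (induction N rule: less_induct)
  case (less N)
  show ?case
  proof (cases "N \<le> 1")
    case True
    then consider "N = 0" | "N = 1" by linarith
    then show ?thesis by cases auto
  next
    case False
    define n where "n = (N + 1) div 2"
    have n: "n < N" "N \<le> 2 * n" "2 * n \<le> N + 1" using False by (auto simp: n_def)
    have "(\<Sum>d=1..N. mangoldt d) \<le> (\<Sum>d=1..2*n. mangoldt d :: real)"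
      using n by (intro sum_mono2) (auto simp: mangoldt_nonneg)
    also have "\<dots> \<le> 6 * real n + 2 * real n * ln 2"
      using sum_mangoldt_double[of n] less.IH[OF n(1)] by linarith
    also have "\<dots> \<le> 8 * real n" 
      using ln_2_less_1 by (simp add: mult_left_le) 
    also have "\<dots> \<le> 4 * real N + 4" using n by linarith
    also have "\<dots> \<le> 6 * real N" using False by linarith
    finally show ?thesis .
  qed
qed

text \<open>For each prime p the powers \<open>p ^ (k + 2)\<close> contribute a geometric series.
  With ln p \<le> 2 sqrt p it is at most 4 p^(-3/2), and this is summable, so unbounded growth of a
  Mertens sum must come from primes.\<close>

lemma sum_mangoldt_nonprime_bounded:
  obtains C :: real where "\<And>N. (\<Sum>n | n \<in> {1..N} \<and> \<not> prime n. mangoldt n / real n) \<le> C"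
proof -
  have summ: "summable (\<lambda>n. 4 * real n powr (-3/2))"
    by (intro summable_mult) (simp add: summable_real_powr_iff)
  show thesis
  proof
    fix N :: nat
    define P where "P = {p. prime p \<and> p \<le> N}"
    have "finite P" unfolding P_def by (rule finite_subset[of _ "{..N}"]) auto
    have "(\<Sum>n | n \<in> {1..N} \<and> \<not> prime n. mangoldt n / real n)
        = (\<Sum>n | n \<in> {1..N} \<and> \<not> prime n \<and> primepow n. mangoldt n / real n)"
      by (intro sum.mono_neutral_right) (auto simp: mangoldt_def)
    also have "\<dots> \<le> (\<Sum>n\<in>(\<lambda>(p, k). p ^ (k + 2)) ` (P \<times> {..<N}). mangoldt n / real n)"
    proof (rule sum_mono2)
      show "{n \<in> {1..N}. \<not> prime n \<and> primepow n} \<subseteq> (\<lambda>(p, k). p ^ (k + 2)) ` (P \<times> {..<N})"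
      proof
        fix n assume n: "n \<in> {n. n \<in> {1..N} \<and> \<not> prime n \<and> primepow n}"
        then obtain p k where pk: "prime p" "k > 0" "n = p ^ k" by (auto simp: primepow_def)
        with n have "k \<noteq> 1" by auto
        with pk have k: "k \<ge> 2" by linarith
        have "k < p ^ k" using pk prime_gt_1_nat by (simp add: power_gt_expt)
        moreover have "p \<le> p ^ k" using pk self_le_power[of p k] prime_ge_1_nat by auto
        ultimately have "(p, k - 2) \<in> P \<times> {..<N}" using n pk k by (auto simp: P_def)
        moreover have "n = p ^ (k - 2 + 2)" using pk(3) k by (metis le_add_diff_inverse2)
        ultimately show "n \<in> (\<lambda>(p, k). p ^ (k + 2)) ` (P \<times> {..<N})" by (metis (mono_tags, lifting) image_eqI old.prod.case)
      qed
    qed (use \<open>finite P\<close> in \<open>auto simp: mangoldt_nonneg\<close>)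
    also have "\<dots> \<le> (\<Sum>(p, k)\<in>P \<times> {..<N}. mangoldt (p ^ (k + 2)) / real (p ^ (k + 2)))"
      using \<open>finite P\<close> by (intro order_trans[OF sum_image_le]) (auto simp: mangoldt_nonneg case_prod_beta o_def)
    also have "\<dots> = (\<Sum>p\<in>P. \<Sum>k<N. mangoldt (p ^ (k + 2)) / real (p ^ (k + 2)))"
      by (rule sum.cartesian_product[symmetric])
    also have "\<dots> \<le> (\<Sum>p\<in>P. 4 * real p powr (-3/2))"
    proof (rule sum_mono)
      fix p assume "p \<in> P"
      then have p: "prime p" "real p \<ge> 2" by (auto simp: P_def dest: prime_ge_2_nat)
      have "(\<Sum>k<N. mangoldt (p ^ (k + 2)) / real (p ^ (k + 2))) = ln (real p) / real p ^ 2 * (\<Sum>k<N. (1 / real p) ^ k)"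
        unfolding sum_distrib_left
      proof (rule sum.cong[OF refl])
        fix k
        have "mangoldt (p ^ (k + 2)) = ln (real p)" using p by (subst mangoldt_primepow) auto
        then show "mangoldt (p ^ (k + 2)) / real (p ^ (k + 2)) = ln (real p) / real p ^ 2 * (1 / real p) ^ k"
          by (simp add: power_one_over power_add field_simps power2_eq_square)
      qed
      also have "(\<Sum>k<N. (1 / real p) ^ k) \<le> (\<Sum>k. (1 / real p) ^ k)"
        using p by (intro sum_le_suminf summable_geometric) auto
      also have "\<dots> = 1 / (1 - 1 / real p)" using p by (intro suminf_geometric) auto
      also have "\<dots> \<le> 2" using p by (simp add: field_simps)
      also have "ln (real p) / real p ^ 2 * 2 \<le> 2 * sqrt (real p) / real p ^ 2 * 2"
      proof -
        have "ln (real p) = 2 * ln (sqrt (real p))" using p by (simp add: ln_sqrt)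
        also have "\<dots> \<le> 2 * sqrt (real p)" using p ln_bound[of "sqrt (real p)"] by simp
        finally show ?thesis by (intro mult_right_mono divide_right_mono) auto
      qed
      also have "\<dots> = 4 * real p powr (-3/2)"
      proof -
        have "sqrt (real p) / real p ^ 2 = real p powr (1/2) / real p powr 2"
          using p by (simp add: powr_half_sqrt)
        also have "\<dots> = real p powr (1/2 - 2)" by (rule powr_diff[symmetric])
        finally show ?thesis by simp
      qed
      finally show "(\<Sum>k<N. mangoldt (p ^ (k + 2)) / real (p ^ (k + 2))) \<le> 4 * real p powr (-3/2)"
        using p by (simp add: mult_left_mono divide_right_mono)
    qed
    also have "\<dots> \<le> (\<Sum>n. 4 * real n powr (-3/2))"
      using \<open>finite P\<close> summ by (intro sum_le_suminf) auto
    finally show "(\<Sum>n | n \<in> {1..N} \<and> \<not> prime n. mangoldt n / real n) \<le> (\<Sum>n. 4 * real n powr (-3/2))" .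
  qed
qed

section \<open>Real characters\<close>

text \<open>A nonprincipal real character in the form the argument uses: \<open>sum_zero\<close>
  keeps the partial sums bounded, \<open>trivalued\<close> makes the divisor sums nonnegative, and
  \<open>vanishes\<close> yields a prime whose powers have divisor sum 1.\<close>

locale real_character =
  fixes chi :: "nat \<Rightarrow> real" and D :: nat
  assumes mult: "chi (a * b) = chi a * chi b"
    and one: "chi 1 = 1"
    and trivalued: "chi n \<in> {-1, 0, 1}"
    and period: "chi (n + D) = chi n"
    and D_pos: "D > 0"
    and sum_zero: "(\<Sum>n<D. chi n) = 0"
    and vanishes: "\<exists>q>1. chi q = 0"
begin

lemma abs_le_1: "\<bar>chi n\<bar> \<le> 1"
  using trivalued[of n] by auto

lemma power: "chi (n ^ k) = chi n ^ k"
  using one by (induction k) (auto simp: mult)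

text \<open>Complete periods cancel, and fewer than \<open>D\<close> terms of size at most 1
  remain.\<close>

lemma partial_sum_bound: "\<bar>\<Sum>k<n. chi k\<bar> \<le> real D"
proof (induction n rule: less_induct)
  case (less n)
  show ?case
  proof (cases "n < D")
    case True
    have "\<bar>\<Sum>k<n. chi k\<bar> \<le> (\<Sum>k<n. 1)"
      by (rule order_trans[OF sum_abs sum_mono]) (rule abs_le_1)
    then show ?thesis using True by simp
  next
    case False
    have "(\<Sum>k<n. chi k) = (\<Sum>k<D. chi k) + (\<Sum>k=D..<n. chi k)"
      using False sum.atLeastLessThan_concat[of 0 D n chi] by (simp add: atLeast0LessThan)
    also have "(\<Sum>k=D..<n. chi k) = (\<Sum>k<n - D. chi k)"
      using False sum.shift_bounds_nat_ivl[of chi 0 D "n - D"]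
      by (simp add: period atLeast0LessThan)
    finally show ?thesis using less.IH[of "n - D"] False D_pos sum_zero by simp
  qed
qed

text \<open>The value L(1) of the Dirichlet series. Its convergence, which gives \<open>lim\<close>
  its meaning, is established in the proof of \<open>L_tail\<close>.\<close>

definition L :: real where "L = lim (\<lambda>N. \<Sum>n=1..<N. chi n / real n)"

lemma sum_inverse_bound:
  assumes "1 \<le> M" "M \<le> N"
  shows "\<bar>\<Sum>n=M..<N. chi n / real n\<bar> \<le> 2 * real D / real M"
proof -
  have "\<bar>\<Sum>n=M..<N. chi n * (1 / real n)\<bar> \<le> 2 * real D * (1 / real M)"
    by (rule abel_bound) (use partial_sum_bound assms in \<open>auto simp: field_simps\<close>)
  then show ?thesis by simp
qed

text \<open>The bound on the blocks from M to N depends on M alone, so the partial sums are Cauchy.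
  Letting N tend to infinity in the same bound estimates the tail.\<close>

lemma L_tail:
  assumes "1 \<le> M"
  shows "\<bar>(\<Sum>n=1..<M. chi n / real n) - L\<bar> \<le> 2 * real D / real M"
proof -
  define S where "S N = (\<Sum>n=1..<N. chi n / real n)" for N
  have diff: "\<bar>S N - S M\<bar> \<le> 2 * real D / real M" if "1 \<le> M" "M \<le> N" for M N
  proof -
    have "S N = S M + (\<Sum>n=M..<N. chi n / real n)"
      using that by (simp add: S_def sum.atLeastLessThan_concat)
    then show ?thesis using sum_inverse_bound[OF that] by simp
  qed
  have "Cauchy S"
  proof (rule CauchyI')
    fix e :: real assume "e > 0"
    obtain M where M: "2 * real D / e < real M" using reals_Archimedean2 by blast
    have "2 * real D / real (Suc M) < e"
      using M \<open>e > 0\<close> by (simp add: field_simps)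
    have "dist (S m) (S n) < e" if "m \<ge> Suc M" "n > m" for m n
    proof -
      have "\<bar>S n - S m\<bar> \<le> 2 * real D / real m" using diff[of m n] that by simp
      also have "\<dots> \<le> 2 * real D / real (Suc M)" using that by (intro divide_left_mono) auto
      also have "\<dots> < e" by fact
      finally show ?thesis by (simp add: dist_real_def abs_minus_commute)
    qed
    then show "\<exists>M. \<forall>m\<ge>M. \<forall>n>m. dist (S m) (S n) < e" by blast
  qed
  then have lim: "S \<longlonglongrightarrow> L"
    unfolding L_def S_def[abs_def] using Cauchy_convergent convergent_LIMSEQ_iff by blast
  have "(\<lambda>N. \<bar>S M - S N\<bar>) \<longlonglongrightarrow> \<bar>S M - L\<bar>"
    by (intro tendsto_intros lim)
  moreover have "\<forall>\<^sub>F N in sequentially. \<bar>S M - S N\<bar> \<le> 2 * real D / real M"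
    using eventually_ge_at_top[of M] by eventually_elim (metis diff assms abs_minus_commute)
  ultimately have "\<bar>S M - L\<bar> \<le> 2 * real D / real M"
    by (rule tendsto_upperbound) simp
  then show ?thesis by (simp only: S_def)
qed

text \<open>Abel summation against ln n / n works from 3 on, where the weight decreases; the terms
  before that are bounded by their absolute values.\<close>

lemma sum_ln_bounded:
  obtains C where "\<And>N. \<bar>\<Sum>n=1..N. chi n * ln (real n) / real n\<bar> \<le> C"
proof
  fix N
  define g where "g = (\<lambda>n. chi n * (ln (real n) / real n))"
  have B: "\<bar>sum g {1..<n}\<bar> \<le> (\<Sum>n\<in>{1..<3}. \<bar>g n\<bar>) + 2 * real D * (ln (real 3) / real 3)" for n
  proof (cases "n \<le> 3")
    case True
    have "\<bar>sum g {1..<n}\<bar> \<le> (\<Sum>n\<in>{1..<n}. \<bar>g n\<bar>)" by (rule sum_abs)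
    also have "\<dots> \<le> (\<Sum>n\<in>{1..<3}. \<bar>g n\<bar>)" using True by (intro sum_mono2) auto
    finally show ?thesis by (simp add: add_increasing2)
  next
    case False
    have "sum g {1..<n} = sum g {1..<3} + sum g {3..<n}"
      using False by (intro sum.atLeastLessThan_concat[symmetric]) auto
    moreover have "\<bar>sum g {1..<3}\<bar> \<le> (\<Sum>n\<in>{1..<3}. \<bar>g n\<bar>)" by (rule sum_abs)
    moreover have "\<bar>sum g {3..<n}\<bar> \<le> 2 * real D * (ln (real 3) / real 3)"
      unfolding g_def
      by (rule abel_bound) (use partial_sum_bound False ln_over_antimono in auto)
    ultimately show ?thesis by linarith
  qed
  show "\<bar>\<Sum>n=1..N. chi n * ln (real n) / real n\<bar>
      \<le> (\<Sum>n\<in>{1..<3}. \<bar>g n\<bar>) + 2 * real D * (ln (real 3) / real 3)"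
    using B[of "Suc N"] by (simp add: g_def atLeastLessThanSuc_atLeastAtMost)
qed

text \<open>Mertens' method: since ln is the divisor sum of \<open>mangoldt\<close>, the bounded sum
  of \<open>chi n * ln n / n\<close> becomes a sum over d whose inner sums are close to
  \<open>L\<close>. The errors are of order d / N and add up to a bounded amount by Chebyshev's
  estimate; then divide by \<open>L\<close>.\<close>

lemma sum_mangoldt_bounded:
  assumes "L \<noteq> 0"
  obtains C where "\<And>N. \<bar>\<Sum>n=1..N. chi n * mangoldt n / real n\<bar> \<le> C"
proof -
  obtain C0 where C0: "\<And>N. \<bar>\<Sum>n=1..N. chi n * ln (real n) / real n\<bar> \<le> C0"
    using sum_ln_bounded by blast
  have "\<bar>L * (\<Sum>d=1..N. chi d * mangoldt d / real d)\<bar> \<le> C0 + 12 * real D" if "N > 0" for N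
  proof -
    define R where "R d = (\<Sum>k=1..N div d. chi k / real k) - L" for d
    have "(\<Sum>n=1..N. chi n * ln (real n) / real n)
        = (\<Sum>n=1..N. \<Sum>d | d dvd n. chi d * mangoldt d / real d * (chi (n div d) / real (n div d)))"
    proof (rule sum.cong[OF refl])
      fix n assume "n \<in> {1..N}"
      then have n: "n > 0" by simp
      then have "ln (real n) = (\<Sum>d | d dvd n. mangoldt d)" by (simp add: mangoldt_sum)
      then have "chi n * ln (real n) / real n = (\<Sum>d | d dvd n. chi n * mangoldt d / real n)"
        by (simp add: sum_distrib_left sum_divide_distrib)
      also have "\<dots> = (\<Sum>d | d dvd n. chi d * mangoldt d / real d * (chi (n div d) / real (n div d)))"
        by (intro sum.cong refl) (auto elim!: dvdE simp: mult)
      finally show "chi n * ln (real n) / real n = \<dots>" .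
    qed
    also have "\<dots> = (\<Sum>d=1..N. \<Sum>k=1..N div d. chi d * mangoldt d / real d * (chi k / real k))"
      by (rule sum_divisors_swap)
    also have "\<dots> = (\<Sum>d=1..N. chi d * mangoldt d / real d * (L + R d))"
      by (simp add: R_def sum_distrib_left)
    finally have eq: "L * (\<Sum>d=1..N. chi d * mangoldt d / real d)
        = (\<Sum>n=1..N. chi n * ln (real n) / real n) - (\<Sum>d=1..N. chi d * mangoldt d / real d * R d)"
      by (simp add: algebra_simps add_divide_distrib sum.distrib sum_distrib_left)
    have "\<bar>\<Sum>d=1..N. chi d * mangoldt d / real d * R d\<bar>
        \<le> (\<Sum>d=1..N. mangoldt d * (2 * real D / real N))"
    proof (rule order_trans[OF sum_abs sum_mono])
      fix d assume d: "d \<in> {1..N}"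
      have "\<bar>R d\<bar> \<le> 2 * real D / real (N div d + 1)"
        using L_tail[of "N div d + 1"] unfolding R_def
        by (simp add: atLeastLessThanSuc_atLeastAtMost)
      also have "\<dots> \<le> 2 * real D * real d / real N"
      proof -
        \<comment> \<open>The exclusive upper limit in \<open>L_tail\<close> supplies the
          \<open>+ 1\<close>, which makes the denominator exceed N / d despite the rounding.\<close>
        have "N < d * (N div d + 1)" using d dividend_less_times_div[of d N] by simp
        then have "real N \<le> real d * real (N div d + 1)"
          by (metis of_nat_le_iff of_nat_mult order_less_imp_le)
        then have "real D * real N \<le> real D * (real d * real (N div d + 1))"
          by (rule mult_left_mono) simp
        then show ?thesis using d by (simp add: field_simps)
      qed
      finally have R: "\<bar>R d\<bar> \<le> 2 * real D * real d / real N" .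
      have "\<bar>chi d * mangoldt d / real d * R d\<bar> = \<bar>chi d\<bar> * (mangoldt d / real d * \<bar>R d\<bar>)"
        using d by (simp add: abs_mult)
      also have "\<dots> \<le> 1 * (mangoldt d / real d * (2 * real D * real d / real N))"
        using R abs_le_1 by (intro mult_mono) (auto simp: mangoldt_nonneg)
      also have "\<dots> = mangoldt d * (2 * real D / real N)" using d by simp
      finally show "\<bar>chi d * mangoldt d / real d * R d\<bar> \<le> mangoldt d * (2 * real D / real N)" .
    qed
    also have "\<dots> = (\<Sum>d=1..N. mangoldt d) * (2 * real D / real N)"
      by (rule sum_distrib_right[symmetric])
    also have "\<dots> \<le> 6 * real N * (2 * real D / real N)"
      by (intro mult_right_mono sum_mangoldt_le) auto
    also have "\<dots> = 12 * real D" using that by simp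
    finally show ?thesis using eq C0[of N] by linarith
  qed
  then have *: "\<bar>\<Sum>d=1..N. chi d * mangoldt d / real d\<bar> \<le> (C0 + 12 * real D) / \<bar>L\<bar>" if "N > 0" for N
    using that assms by (simp add: abs_mult field_simps)
  \<comment> \<open>The maximum with 0 covers the empty sum at N = 0.\<close>
  have "\<bar>\<Sum>d=1..N. chi d * mangoldt d / real d\<bar> \<le> max 0 ((C0 + 12 * real D) / \<bar>L\<bar>)" for N
    using *[of N] by (cases "N = 0") (auto simp: le_max_iff_disj)
  then show thesis by (rule that)
qed

end

section \<open>Inequalities between geometric sums\<close>

text \<open>Pair the terms with indices i and n - 1 - i: their geometric mean is
  \<open>u ^ (n - 1)\<close>, so their sum is at least twice that.\<close>

lemma geometric_sum_pairing:
  fixes u :: real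
  assumes "u > 0"
  shows "real n * u ^ (n - 1) \<le> (\<Sum>i<n. (u\<^sup>2) ^ i)"
proof -
  have "2 * (real n * u ^ (n - 1)) = (\<Sum>i<n. 2 * u ^ (n - 1))" by simp
  also have "\<dots> \<le> (\<Sum>i<n. (u\<^sup>2) ^ i + (u\<^sup>2) ^ (n - Suc i))"
  proof (rule sum_mono)
    fix i assume "i \<in> {..<n}"
    then have "u ^ i * u ^ (n - Suc i) = u ^ (n - 1)" by (simp add: power_add[symmetric])
    moreover have "2 * (u ^ i * u ^ (n - Suc i)) \<le> (u ^ i)\<^sup>2 + (u ^ (n - Suc i))\<^sup>2"
      using sum_squares_bound[of "u ^ i" "u ^ (n - Suc i)"] by simp
    ultimately show "2 * u ^ (n - 1) \<le> (u\<^sup>2) ^ i + (u\<^sup>2) ^ (n - Suc i)"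
      by (simp add: power_mult[symmetric] mult.commute)
  qed
  also have "\<dots> = 2 * (\<Sum>i<n. (u\<^sup>2) ^ i)"
    by (simp add: sum.distrib sum.nat_diff_reindex)
  finally show ?thesis by simp
qed

text \<open>After division by \<open>(1 - t)\<^sup>2\<close> the right side is a product of two
  geometric sums. The pairing bound with u = sqrt t applies to both and leaves u^(2 n - 1), which is
  at least t^n.\<close>

lemma one_minus_power_mult_ge:
  fixes t :: real
  assumes "0 < t" "t < 1"
  shows "real n * real (Suc n) * t ^ n * (1 - t)\<^sup>2 \<le> (1 - t ^ n) * (1 - t ^ Suc n)"
proof -
  define u where "u = sqrt t"
  have u: "0 < u" "u < 1" "u\<^sup>2 = t" using assms by (auto simp: u_def)
  have s: "(1 - t) * (\<Sum>i<k. t ^ i) = 1 - t ^ k" for k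
    by (rule one_diff_power_eq[symmetric])
  have "real n * real (Suc n) * t ^ n \<le> (real n * u ^ (n - 1)) * (real (Suc n) * u ^ n)"
  proof (cases n)
    case (Suc k)
    have "t ^ n = u ^ (2 * n)" using u by (simp add: power_mult)
    also have "\<dots> \<le> u ^ (n - 1 + n)" using u by (intro power_decreasing) auto
    finally show ?thesis by (simp add: power_add mult_ac mult_left_mono del: of_nat_Suc)
  qed simp
  also have "\<dots> \<le> (\<Sum>i<n. t ^ i) * (\<Sum>i<Suc n. t ^ i)"
    using geometric_sum_pairing[of u n] geometric_sum_pairing[of u "Suc n"] u assms
    by (intro mult_mono) (auto intro!: sum_nonneg simp del: of_nat_Suc sum.lessThan_Suc)
  finally have "real n * real (Suc n) * t ^ n * (1 - t)\<^sup>2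
      \<le> (\<Sum>i<n. t ^ i) * (\<Sum>i<Suc n. t ^ i) * (1 - t)\<^sup>2"
    by (rule mult_right_mono) simp
  also have "\<dots> = (1 - t ^ n) * (1 - t ^ Suc n)"
    by (simp only: s[symmetric] power2_eq_square mult_ac)
  finally show ?thesis .
qed

section \<open>Nonvanishing of L(1)\<close>

text \<open>
  If \<open>L = 0\<close>, the summand \<open>1 / (n (1 - t))\<close> contributes nothing to the sum of \<open>chi n\<close> times this weight, so
  that sum is minus the Lambert series of \<open>chi\<close>; by monotonicity of the weight it stays bounded as \<open>t\<close>
  tends to 1.
\<close>
definition lambert_weight :: "real \<Rightarrow> nat \<Rightarrow> real" where
  "lambert_weight t n = 1 / (real n * (1 - t)) - t ^ n / (1 - t ^ n)"

text \<open>The decrease of 1 / (n (1 - t)) outweighs that of t^n / (1 - t^n); with denominators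
  cleared this is \<open>one_minus_power_mult_ge\<close>.\<close>

lemma lambert_weight_antimono:
  assumes "0 < t" "t < 1" "n > 0"
  shows "lambert_weight t (Suc n) \<le> lambert_weight t n"
proof -
  have pos: "0 < 1 - t" "0 < 1 - t ^ n" "0 < 1 - t ^ Suc n"
    using assms power_Suc_less_one[of t n] by (auto simp: power_less_one_iff)
  have "t ^ n / (1 - t ^ n) - t ^ Suc n / (1 - t ^ Suc n)
      = t ^ n * (1 - t) / ((1 - t ^ n) * (1 - t ^ Suc n))"
    using pos by (simp add: field_simps)
  also have "\<dots> \<le> 1 / (real n * real (Suc n) * (1 - t))"
    using one_minus_power_mult_ge[OF assms(1,2), of n] pos assms(3)
    by (simp add: divide_simps power2_eq_square mult_ac del: of_nat_Suc power_Suc)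
  also have "\<dots> = 1 / (real n * (1 - t)) - 1 / (real (Suc n) * (1 - t))"
    using pos assms(3) by (simp add: divide_simps)
  finally show ?thesis by (simp add: lambert_weight_def)
qed

lemma lambert_weight_nonneg:
  assumes "0 < t" "t < 1" "n > 0"
  shows "lambert_weight t n \<ge> 0"
proof -
  have pos: "0 < 1 - t" "0 < 1 - t ^ n"
    using assms by (auto simp: power_less_one_iff)
  have "real n * t ^ n = (\<Sum>i<n. t ^ n)" by simp
  also have "\<dots> \<le> (\<Sum>i<n. t ^ i)"
    using assms by (intro sum_mono power_decreasing) auto
  finally have "real n * t ^ n * (1 - t) \<le> (\<Sum>i<n. t ^ i) * (1 - t)"
    using pos by (intro mult_right_mono) auto
  also have "\<dots> = 1 - t ^ n" by (simp add: one_diff_power_eq mult.commute)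
  finally show ?thesis
    using pos assms(3)
    by (simp add: lambert_weight_def pos_le_divide_eq pos_divide_le_eq mult_ac)
qed

text \<open>The exponent i can be read off from \<open>p ^ i * d\<close> as the multiplicity of p,
  whence injectivity. This splits a divisor sum at one prime.\<close>

lemma divisors_prime_power_mult:
  fixes p b :: nat
  assumes "prime p" "\<not> p dvd b" "b > 0"
  shows "bij_betw (\<lambda>(i, d). p ^ i * d) ({..k} \<times> {d. d dvd b}) {d. d dvd p ^ k * b}"
proof (rule bij_betw_imageI)
  have mu: "multiplicity p (p ^ i * d) = i" if "d dvd b" for i d
  proof -
    have "\<not> p dvd d" "d \<noteq> 0" using that assms dvd_trans by auto
    then show ?thesis
      using assms(1) by (simp add: prime_elem_multiplicity_mult_distrib not_dvd_imp_multiplicity_0)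
  qed
  show "inj_on (\<lambda>(i, d). p ^ i * d) ({..k} \<times> {d. d dvd b})"
  proof (rule inj_onI, clarsimp)
    fix i d j e assume de: "d dvd b" "e dvd b" and eq: "p ^ i * d = p ^ j * e"
    have "i = j" using mu[of d i] mu[of e j] de eq by simp
    with eq assms show "i = j \<and> d = e" by auto
  qed
  show "(\<lambda>(i, d). p ^ i * d) ` ({..k} \<times> {d. d dvd b}) = {d. d dvd p ^ k * b}"
  proof (intro equalityI subsetI)
    fix x assume "x \<in> {d. d dvd p ^ k * b}"
    then obtain a c where "x = a * c" "a dvd p ^ k" "c dvd b"
      using division_decomp[of x "p ^ k" b] by auto
    moreover then obtain i where "i \<le> k" "a = p ^ i"
      using assms(1) divides_primepow_nat by blast
    ultimately show "x \<in> (\<lambda>(i, d). p ^ i * d) ` ({..k} \<times> {d. d dvd b})" by force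
  qed (auto intro: mult_dvd_mono le_imp_power_dvd)
qed

context real_character
begin

text \<open>Splitting off one prime power makes the divisor sum a product of local factors. Each is
  k + 1, 1, or an alternating sum equal to 0 or 1, according to the value of
  \<open>chi p\<close>.\<close>

lemma divisor_sum_nonneg: "n > 0 \<Longrightarrow> (\<Sum>d | d dvd n. chi d) \<ge> 0"
proof (induction n rule: less_induct)
  case (less n)
  show ?case
  proof (cases "n = 1")
    case True
    then show ?thesis using one by simp
  next
    case False
    then obtain p where p: "prime p" "p dvd n" using prime_factor_nat by blast
    obtain b where b: "n = p ^ multiplicity p n * b" "\<not> p dvd b"
      using multiplicity_decompose'[of n p] less.prems p by (metis not_prime_unit not_gr_zero)
    define k where "k = multiplicity p n"
    have "k > 0" using p less.prems by (simp add: k_def prime_multiplicity_gt_zero_iff)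
    have n: "n = p ^ k * b" using b by (simp add: k_def)
    have "b > 0" using less.prems n by (auto intro: gr0I)
    have "1 < p ^ k" using p \<open>k > 0\<close> by (metis one_less_power prime_gt_1_nat)
    then have "b < n" using \<open>b > 0\<close> n by simp
    have "(\<Sum>d | d dvd n. chi d) = (\<Sum>(i, d)\<in>{..k} \<times> {d. d dvd b}. chi (p ^ i * d))"
      unfolding n using sum.reindex_bij_betw[OF divisors_prime_power_mult[OF p(1) b(2) \<open>b > 0\<close>], of chi k]
      by (simp add: case_prod_beta)
    also have "\<dots> = (\<Sum>i\<le>k. chi p ^ i) * (\<Sum>d | d dvd b. chi d)"
      by (simp add: sum.cartesian_product[symmetric] sum_product mult power)
    also have "\<dots> \<ge> 0"
    proof (rule mult_nonneg_nonneg)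
      have "(\<Sum>i\<le>k. chi p ^ i) \<ge> 0"
        using trivalued[of p]
      proof (elim insertE)
        assume "chi p = -1"
        have "(\<Sum>i\<le>k. (-1::real) ^ i) \<ge> 0" by (induction k rule: nat_induct2) auto
        then show ?thesis using \<open>chi p = -1\<close> by simp
      qed (auto intro!: sum_nonneg)
      then show "(\<Sum>i\<le>k. chi p ^ i) \<ge> 0" .
    qed (use less.IH[OF \<open>b < n\<close> \<open>b > 0\<close>] in simp)
    finally show ?thesis .
  qed
qed

text \<open>
  This makes the power series of the divisor sums unbounded as \<open>t\<close> tends to 1. The squares, which are
  the usual choice here, are not needed.
\<close>
lemma divisor_sum_vanishing_power:
  assumes "prime q" "chi q = 0"
  shows "(\<Sum>d | d dvd q ^ k. chi d) = 1"
proof -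
  have "{d. d dvd q ^ k} = (\<lambda>i. q ^ i) ` {..k}"
    using divides_primepow_nat[OF assms(1)] by (auto intro: le_imp_power_dvd)
  moreover have "inj_on (\<lambda>i. q ^ i) {..k}"
    using prime_gt_1_nat[OF assms(1)] by (auto intro: inj_onI)
  ultimately have "(\<Sum>d | d dvd q ^ k. chi d) = (\<Sum>i\<le>k. chi q ^ i)"
    by (simp add: sum.reindex power)
  also have "\<dots> = 1"
    using assms(2) by (induction k) auto
  finally show ?thesis .
qed

text \<open>A finite form of the Lambert series comparison. The three terms bound the error of the
  partial sum of L(1) = 0, the sum against the decreasing weights, and the loss from cutting each
  geometric series after \<open>N div d\<close> terms.\<close>

lemma lambert_sum_le:
  assumes "L = 0" "0 < t" "t < 1" "N > 0"
  shows "(\<Sum>n=1..N. (\<Sum>d | d dvd n. chi d) * t ^ n)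
    \<le> 2 * real D / (real N * (1 - t)) + 2 * real D + real N * t ^ N / (1 - t)"
proof -
  have pos: "0 < 1 - t ^ d" "1 - t \<le> 1 - t ^ d" if "d > 0" for d
    using assms that power_le_one[of t d] power_decreasing[of 1 d t] by (auto simp: power_less_one_iff)
  have "(\<Sum>n=1..N. (\<Sum>d | d dvd n. chi d) * t ^ n) 
      = (\<Sum>n=1..N. \<Sum>d | d dvd n. chi d * (t ^ d) ^ (n div d))"
    by (auto simp: sum_distrib_right power_mult[symmetric] intro!: sum.cong)
  also have "\<dots> = (\<Sum>d=1..N. \<Sum>k=1..N div d. chi d * (t ^ d) ^ k)"
    by (rule sum_divisors_swap)
  also have "\<dots> = (\<Sum>d=1..N. chi d * (t ^ d / (1 - t ^ d)) - chi d * (t ^ (d * (N div d + 1)) / (1 - t ^ d)))"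
  proof (rule sum.cong[OF refl])
    fix d assume d: "d \<in> {1..N}"
    have "(\<Sum>k=1..N div d. (t ^ d) ^ k) = (t ^ d - (t ^ d) ^ (N div d + 1)) / (1 - t ^ d)"
      using sum_gp[of "t ^ d" 1 "N div d"] pos[of d] d by (auto simp: div_greater_zero_iff)
    moreover have "(t ^ d) ^ (N div d + 1) = t ^ (d * (N div d + 1))"
      by (simp only: power_mult[symmetric])
    ultimately show "(\<Sum>k=1..N div d. chi d * (t ^ d) ^ k)
        = chi d * (t ^ d / (1 - t ^ d)) - chi d * (t ^ (d * (N div d + 1)) / (1 - t ^ d))"
      by (simp add: sum_distrib_left[symmetric] diff_divide_distrib right_diff_distrib del: power_Suc)
  qed
  also have "\<dots> = (\<Sum>d=1..N. chi d / real d) / (1 - t) - (\<Sum>d=1..N. chi d * lambert_weight t d)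
      - (\<Sum>d=1..N. chi d * (t ^ (d * (N div d + 1)) / (1 - t ^ d)))"
    by (simp add: lambert_weight_def sum_subtractf sum_divide_distrib right_diff_distrib)
  also have "\<dots> \<le> 2 * real D / (real N * (1 - t)) + 2 * real D + real N * t ^ N / (1 - t)"
  proof -
    have "\<bar>\<Sum>d=1..N. chi d / real d\<bar> \<le> 2 * real D / real (Suc N)"
      using L_tail[of "Suc N"] assms(1) by (simp add: atLeastLessThanSuc_atLeastAtMost)
    also have "\<dots> \<le> 2 * real D / real N" using assms(4) by (intro divide_left_mono) auto
    finally have "(\<Sum>d=1..N. chi d / real d) \<le> 2 * real D / real N" by linarith
    then have 1: "(\<Sum>d=1..N. chi d / real d) / (1 - t) \<le> 2 * real D / (real N * (1 - t))"
      using assms divide_right_mono[of _ "2 * real D / real N" "1 - t"] by simp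
    have "\<bar>\<Sum>d=1..<Suc N. chi d * lambert_weight t d\<bar> \<le> 2 * real D * lambert_weight t 1"
      by (rule abel_bound)
        (use partial_sum_bound lambert_weight_nonneg lambert_weight_antimono assms in auto)
    \<comment> \<open>This value makes the middle bound independent of t.\<close>
    also have "lambert_weight t 1 = 1"
      using assms by (simp add: lambert_weight_def diff_divide_distrib[symmetric])
    finally have 2: "\<bar>\<Sum>d=1..N. chi d * lambert_weight t d\<bar> \<le> 2 * real D"
      by (simp add: atLeastLessThanSuc_atLeastAtMost)
    have "\<bar>\<Sum>d=1..N. chi d * (t ^ (d * (N div d + 1)) / (1 - t ^ d))\<bar> \<le> (\<Sum>d=1..N. t ^ N / (1 - t))"
    proof (rule order_trans[OF sum_abs sum_mono])
      fix d assume d: "d \<in> {1..N}"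
      have "N \<le> d * (N div d + 1)" using d dividend_less_times_div[of d N] by simp
      then have "t ^ (d * (N div d + 1)) / (1 - t ^ d) \<le> t ^ N / (1 - t)"
        using pos[of d] d assms by (intro frac_le power_decreasing) auto
      then have "\<bar>chi d\<bar> * (t ^ (d * (N div d + 1)) / (1 - t ^ d)) \<le> 1 * (t ^ N / (1 - t))"
        using abs_le_1[of d] pos[of d] d assms by (intro mult_mono) auto
      then show "\<bar>chi d * (t ^ (d * (N div d + 1)) / (1 - t ^ d))\<bar> \<le> t ^ N / (1 - t)"
        using pos[of d] d assms by (simp add: abs_mult)
    qed
    then show ?thesis using 1 2 by (simp add: abs_le_iff)
  qed
  finally show ?thesis .
qed

text \<open>For a prime q with \<open>chi q = 0\<close>, the indices \<open>q ^ k\<close> with k < K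
  have divisor sum 1 and all other positive indices a nonnegative one. If \<open>L\<close> were 0,
  letting N tend to infinity in \<open>lambert_sum_le\<close> and then t to 1 would give K \<le> 2
  D.\<close>

lemma L_nonzero: "L \<noteq> 0"
proof
  assume L0: "L = 0"
  obtain q where q: "prime q" "chi q = 0"
  proof -
    \<comment> \<open>The least zero above 1 is prime, since in a proper factorization one factor
      would be a smaller zero.\<close>
    define r where "r = (LEAST r. r > 1 \<and> chi r = 0)"
    have r: "r > 1" "chi r = 0" and least: "s > 1 \<Longrightarrow> chi s = 0 \<Longrightarrow> r \<le> s" for s
      using LeastI_ex[OF vanishes] Least_le[of "\<lambda>r. r > 1 \<and> chi r = 0"] by (auto simp: r_def)
    have "prime r"
    proof (rule ccontr)
      assume "\<not> prime r"
      with r(1) obtain a b where ab: "r = a * b" "a \<noteq> 1" "a \<noteq> r"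
        by (auto simp: prime_nat_iff elim!: dvdE)
      then have "1 < a" "1 < b" "a < r" "b < r"
        using r(1) by (auto intro!: Suc_lessI gr0I)
      then have "chi a = 0 \<or> chi b = 0" using r(2) ab(1) mult[of a b] by simp
      then show False using least \<open>1 < a\<close> \<open>1 < b\<close> \<open>a < r\<close> \<open>b < r\<close> by (meson leD)
    qed
    then show thesis using that r(2) by blast
  qed
  \<comment> \<open>Chosen to exceed the bound 2 D.\<close>
  define K where "K = 2 * D + 2"
  define N0 where "N0 = q ^ K"
  have lower: "(\<Sum>k<K. t ^ (q ^ k)) \<le> 2 * real D" if t: "0 < t" "t < 1" for t
  proof -
    have "(\<Sum>k<K. t ^ (q ^ k)) \<le> 2 * real D / (real N * (1 - t)) + 2 * real D + real N * t ^ N / (1 - t)"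
      if "N \<ge> N0" for N
    proof -
      have q1: "q > 1" using q prime_gt_1_nat by blast
      have "(\<Sum>k<K. t ^ (q ^ k)) = (\<Sum>k<K. (\<Sum>d | d dvd q ^ k. chi d) * t ^ (q ^ k))"
        using divisor_sum_vanishing_power[OF q] by simp
      also have "\<dots> = (\<Sum>n\<in>(\<lambda>k. q ^ k) ` {..<K}. (\<Sum>d | d dvd n. chi d) * t ^ n)"
        using q1 by (subst sum.reindex) (auto intro: inj_onI)
      also have "\<dots> \<le> (\<Sum>n=1..N. (\<Sum>d | d dvd n. chi d) * t ^ n)"
      proof (rule sum_mono2)
        show "(\<lambda>k. q ^ k) ` {..<K} \<subseteq> {1..N}"
        proof clarsimp
          fix k assume "k < K"
          then have "q ^ k \<le> q ^ K" using q1 by (intro power_increasing) auto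
          then have "q ^ k \<le> N" using that unfolding N0_def by (rule order_trans)
          then show "Suc 0 \<le> q ^ k \<and> q ^ k \<le> N" using q1 by (simp add: Suc_le_eq)
        qed
      qed (use t divisor_sum_nonneg in auto)
      also have "N > 0" using that q1 by (simp add: N0_def) (metis gr0I le_zero_eq not_less0 power_eq_0_iff)
      note lambert_sum_le[OF L0 t this]
      finally show ?thesis .
    qed
    moreover have "(\<lambda>N. 2 * real D / (real N * (1 - t)) + 2 * real D + real N * t ^ N / (1 - t))
        \<longlonglongrightarrow> 0 + 2 * real D + 0 / (1 - t)"
    proof (intro tendsto_intros)
      show "(\<lambda>N. 2 * real D / (real N * (1 - t))) \<longlonglongrightarrow> 0"
        using tendsto_mult_right_zero[OF lim_1_over_n, of "2 * real D / (1 - t)"] by (simp add: mult.commute)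
      show "(\<lambda>N. real N * t ^ N) \<longlonglongrightarrow> 0"
        using t by (intro powser_times_n_limit_0) auto
    qed (use t in auto)
    ultimately show ?thesis
      by (intro tendsto_lowerbound[where F = sequentially and f = "\<lambda>N. 2 * real D / (real N * (1 - t)) + 2 * real D + real N * t ^ N / (1 - t)"])
        (auto simp: eventually_at_top_linorder)
  qed
  have "((\<lambda>t. \<Sum>k<K. t ^ (q ^ k)) \<longlongrightarrow> (\<Sum>k<K. 1 ^ (q ^ k))) (at_left (1::real))"
    by (intro tendsto_intros)
  moreover have "\<forall>\<^sub>F t in at_left (1::real). (\<Sum>k<K. t ^ (q ^ k)) \<le> 2 * real D"
    using eventually_at_left_real[of 0 "1::real"] by (auto elim!: eventually_mono intro: lower)
  ultimately have "(\<Sum>k<K. (1::real) ^ (q ^ k)) \<le> 2 * real D"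
    by (rule tendsto_upperbound) auto
  then show False by (simp add: K_def)
qed

end

section \<open>Primes with prescribed Legendre symbols\<close>

lemma Legendre_cong: "[a = b] (mod p) \<Longrightarrow> Legendre a p = Legendre b p"
  by (simp add: Legendre_def QuadRes_def cong_def)

lemma Legendre_values: "Legendre a p \<in> {-1, 0, 1}"
  by (simp add: Legendre_def)

lemma Legendre_1: "p > 1 \<Longrightarrow> Legendre 1 p = 1"
  by (auto simp: Legendre_def QuadRes_def cong_def intro: exI[of _ 1])

lemma Legendre_eq_0_iff: "Legendre (int n) (int q) = 0 \<longleftrightarrow> q dvd n"
  by (simp add: Legendre_def cong_0_iff)

text \<open>Euler's criterion gives the identity modulo p; the two sides differ by at most 2, which
  is less than p.\<close>

lemma Legendre_mult:
  assumes "prime p" "2 < p"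
  shows "Legendre (a * b) (int p) = Legendre a (int p) * Legendre b (int p)"
proof -
  have "[Legendre a p * Legendre b p = a ^ ((p - 1) div 2) * b ^ ((p - 1) div 2)] (mod p)"
    by (intro cong_mult euler_criterion assms)
  then have "[Legendre (a * b) p = Legendre a p * Legendre b p] (mod p)"
    using euler_criterion[OF assms, of "a * b"] by (simp add: power_mult_distrib) (meson cong_sym cong_trans)
  then have "int p dvd Legendre (a * b) p - Legendre a p * Legendre b p"
    by (simp add: cong_iff_dvd_diff)
  moreover have "\<bar>Legendre (a * b) p - Legendre a p * Legendre b p\<bar> \<le> 2"
    using Legendre_values[of "a * b" p] Legendre_values[of a p] Legendre_values[of b p] by auto
  ultimately show ?thesis using assms(2) dvd_imp_le_int[of "Legendre (a * b) p - Legendre a p * Legendre b p" "int p"]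
    by fastforce
qed

text \<open>If every nonzero residue were a square, squaring would map the nonzero residues onto
  themselves and so be injective, but 1 and q - 1 have the same square.\<close>

lemma exists_nonresidue:
  assumes "prime q" "2 < q"
  obtains b :: nat where "Legendre (int b) (int q) = -1"
proof -
  have "\<exists>b\<in>{1..<q}. Legendre (int b) (int q) = -1"
  proof (rule ccontr)
    assume H: "\<not> ?thesis"
    have res: "QuadRes (int q) (int b)" if "b \<in> {1..<q}" for b
    proof -
      have "\<not> q dvd b" using that by (auto dest: nat_dvd_not_less)
      with H that show ?thesis by (auto simp: Legendre_def cong_0_iff split: if_splits)
    qed
    have "{1..<q} \<subseteq> (\<lambda>x. x\<^sup>2 mod q) ` {1..<q}"
    proof
      fix b assume b: "b \<in> {1..<q}"
      then obtain y where y: "[y\<^sup>2 = int b] (mod int q)" using res unfolding QuadRes_def by blast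
      define x where "x = nat (y mod int q)"
      have x: "int x = y mod int q" using assms(2) by (simp add: x_def)
      have "[int (x\<^sup>2) = int b] (mod int q)"
        using y by (simp add: x cong_def power_mod)
      then have "[x\<^sup>2 = b] (mod q)" by (simp only: cong_int_iff)
      then have eq: "x\<^sup>2 mod q = b" using b by (simp add: cong_def)
      have "x \<noteq> 0"
      proof
        assume "x = 0"
        with eq b show False by simp
      qed
      moreover have "x < q" using x assms(2) by (metis of_nat_less_iff pos_mod_bound of_nat_0_less_iff less_trans zero_less_numeral)
      ultimately show "b \<in> (\<lambda>x. x\<^sup>2 mod q) ` {1..<q}" using eq by (intro image_eqI[of _ _ x]) auto
    qed
    then have "card {1..<q} \<le> card ((\<lambda>x. x\<^sup>2 mod q) ` {1..<q})"
      by (intro card_mono) auto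
    then have "inj_on (\<lambda>x. x\<^sup>2 mod q) {1..<q}"
      by (intro eq_card_imp_inj_on antisym card_image_le) auto
    moreover have "(q - 1)\<^sup>2 mod q = 1\<^sup>2 mod q"
    proof -
      have "(q - 1)\<^sup>2 = 1 + q * (q - 2)"
        using assms(2) by (auto simp: power2_eq_square algebra_simps elim!: less_natE)
      then show ?thesis by (simp only: mod_mult_self2 power_one)
    qed
    ultimately have "q - 1 = 1"
      using assms(2) by (intro inj_onD[of "\<lambda>x. x\<^sup>2 mod q" "{1..<q}" "q - 1" 1]) auto
    then show False using assms(2) by simp
  qed
  then show thesis using that by blast
qed

text \<open>A real Dirichlet character modulo \<open>\<Prod>S\<close> when S is a finite nonempty
  set of odd primes. The empty set gives the constant 1, which later produces the main term ln
  N.\<close>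

definition legendre_char :: "nat set \<Rightarrow> nat \<Rightarrow> real" where
  "legendre_char S n = (\<Prod>q\<in>S. real_of_int (Legendre (int n) (int q)))"

lemma legendre_char_mult:
  assumes "\<And>q. q \<in> S \<Longrightarrow> prime q \<and> 2 < q"
  shows "legendre_char S (a * b) = legendre_char S a * legendre_char S b"
  unfolding legendre_char_def prod.distrib[symmetric]
  by (intro prod.cong refl) (use assms in \<open>simp add: Legendre_mult\<close>)

lemma legendre_char_cong:
  assumes "finite S" "[a = b] (mod \<Prod>S)"
  shows "legendre_char S a = legendre_char S b"
  unfolding legendre_char_def
proof (intro prod.cong refl)
  fix q assume "q \<in> S"
  then have "[a = b] (mod q)" using assms by (metis cong_dvd_modulus_nat dvd_prodI)
  then have "[int a = int b] (mod int q)" by (simp only: cong_int_iff)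
  then show "real_of_int (Legendre (int a) (int q)) = real_of_int (Legendre (int b) (int q))"
    by (simp add: Legendre_cong)
qed

lemma legendre_char_values: "finite S \<Longrightarrow> legendre_char S n \<in> {-1, 0, 1}"
proof (induction S rule: finite_induct)
  case (insert q S)
  then show ?case using Legendre_values[of "int n" "int q"]
    by (auto simp: legendre_char_def)
qed (simp add: legendre_char_def)

lemma legendre_char_eq_0:
  assumes "finite S" "q \<in> S" "q dvd n"
  shows "legendre_char S n = 0"
  unfolding legendre_char_def
  by (rule prod_zero) (use assms Legendre_eq_0_iff in auto)

text \<open>By the Chinese remainder theorem some b is a nonresidue modulo one chosen prime of S and
  congruent to 1 modulo the others.\<close>

lemma legendre_char_minus_one:
  assumes "finite S" "S \<noteq> {}" "\<And>q. q \<in> S \<Longrightarrow> prime q \<and> 2 < q"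
  obtains b where "legendre_char S b = -1"
proof -
  obtain r where r: "r \<in> S" using assms(2) by blast
  obtain g where g: "Legendre (int g) (int r) = -1"
    using exists_nonresidue[of r] assms(3)[OF r] by blast
  have "\<forall>i\<in>S. \<forall>j\<in>S. i \<noteq> j \<longrightarrow> coprime i j"
    using assms(3) primes_coprime by blast
  then obtain b where b: "\<forall>q\<in>S. [b = (if q = r then g else 1)] (mod q)"
    using chinese_remainder_nat[OF assms(1), of "\<lambda>q. q" "\<lambda>q. if q = r then g else 1"] by auto
  have "legendre_char S b = (\<Prod>q\<in>S. if q = r then -1 else 1)"
    unfolding legendre_char_def
  proof (intro prod.cong refl)
    fix q assume q: "q \<in> S"
    then have "[int b = int (if q = r then g else 1)] (mod int q)" using b by (simp only: cong_int_iff)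
    then have "Legendre (int b) (int q) = Legendre (int (if q = r then g else 1)) (int q)"
      by (rule Legendre_cong)
    then show "real_of_int (Legendre (int b) (int q)) = (if q = r then -1 else 1)"
      using g Legendre_1[of "int q"] assms(3)[OF q] by auto
  qed
  also have "\<dots> = -1" using assms(1) r by simp
  finally show thesis by (rule that)
qed

lemma real_character_legendre_char:
  assumes "finite S" "S \<noteq> {}" "\<And>q. q \<in> S \<Longrightarrow> prime q \<and> 2 < q"
  shows "real_character (legendre_char S) (\<Prod>S)"
proof
  let ?D = "\<Prod>S"
  note multS = legendre_char_mult[OF assms(3)]
  show D: "?D > 0" using assms by (intro prod_pos) (auto intro: prime_gt_0_nat)
  show "legendre_char S (a * b) = legendre_char S a * legendre_char S b" for a b
    by (rule multS)
  show "legendre_char S 1 = 1"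
    unfolding legendre_char_def
  proof (intro prod.neutral ballI)
    fix q assume "q \<in> S"
    then show "real_of_int (Legendre (int 1) (int q)) = 1"
      using assms(3)[of q] Legendre_1[of "int q"] by simp
  qed
  show "legendre_char S n \<in> {-1, 0, 1}" for n by (rule legendre_char_values[OF assms(1)])
  show "legendre_char S (n + ?D) = legendre_char S n" for n
    by (rule legendre_char_cong[OF assms(1)]) (simp add: cong_def)
  obtain r where r: "r \<in> S" using assms(2) by blast
  have "legendre_char S r = 0" using assms(1) r by (rule legendre_char_eq_0) simp
  then show "\<exists>q>1. legendre_char S q = 0" using assms(3)[OF r] by (intro exI[of _ r]) auto
  obtain b where b: "legendre_char S b = -1" using legendre_char_minus_one[OF assms] by blast
  have "coprime b ?D"
  proof (rule prod_coprime_right)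
    fix q assume q: "q \<in> S"
    have "\<not> q dvd b"
    proof
      assume "q dvd b"
      with assms(1) q have "legendre_char S b = 0" by (rule legendre_char_eq_0)
      with b show False by simp
    qed
    then show "coprime b q" using assms(3)[OF q] prime_imp_coprime coprime_commute by blast
  qed
  \<comment> \<open>Multiplication by b permutes the residues and changes the sign of the character,
    so the sum over a period equals its own negative.\<close>
  have "inj_on (\<lambda>n. b * n mod ?D) {..<?D}"
  proof (rule inj_onI)
    fix x y assume "x \<in> {..<?D}" "y \<in> {..<?D}" "b * x mod ?D = b * y mod ?D"
    then have "[x = y] (mod ?D)"
      using \<open>coprime b ?D\<close> by (simp add: cong_def[symmetric] cong_mult_lcancel_nat coprime_commute)
    with \<open>x \<in> _\<close> \<open>y \<in> _\<close> show "x = y" by (simp add: cong_def)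
  qed
  moreover from this have "(\<lambda>n. b * n mod ?D) ` {..<?D} = {..<?D}"
    using D by (intro endo_inj_surj) auto
  ultimately have "bij_betw (\<lambda>n. b * n mod ?D) {..<?D} {..<?D}"
    by (rule bij_betw_imageI)
  then have "(\<Sum>n<?D. legendre_char S n) = (\<Sum>n<?D. legendre_char S (b * n mod ?D))"
    by (rule sum.reindex_bij_betw[symmetric])
  also have "\<dots> = (\<Sum>n<?D. legendre_char S (b * n))"
    by (intro sum.cong refl legendre_char_cong[OF assms(1)]) (simp add: cong_def)
  also have "\<dots> = - (\<Sum>n<?D. legendre_char S n)"
    by (simp add: multS b sum_negf)
  finally show "(\<Sum>n<?D. legendre_char S n) = 0" by simp
qed

text \<open>Weight \<open>mangoldt n / n\<close> by \<open>w\<close>. Expanding \<open>w\<close>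
  into characters gives ln N from the empty set and bounded sums from all other sets. Were the set
  of good primes finite, the weighted sum would be bounded, since \<open>w\<close> vanishes at every
  other prime outside Q.\<close>

theorem infinite_primes_prescribed_Legendre:
  fixes \<epsilon> :: "nat \<Rightarrow> int"
  assumes fin: "finite Q" and Q: "\<And>q. q \<in> Q \<Longrightarrow> prime q \<and> 2 < q"
    and eps: "\<And>q. q \<in> Q \<Longrightarrow> \<epsilon> q \<in> {-1, 1}"
  shows "infinite {p. prime p \<and> (\<forall>q\<in>Q. Legendre (int p) (int q) = \<epsilon> q)}" (is "infinite ?G")
proof
  assume finG: "finite ?G"
  \<comment> \<open>Each factor is 2 if the symbol is the prescribed one, 0 if it is the opposite
    one, and 1 if q divides n.\<close>
  define w where "w n = (\<Prod>q\<in>Q. real_of_int (1 + \<epsilon> q * Legendre (int n) (int q)))" for n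
  define e where "e S = (\<Prod>q\<in>S. real_of_int (\<epsilon> q))" for S
  have factor: "real_of_int (1 + \<epsilon> q * Legendre (int n) (int q)) \<in> {0..2}" if "q \<in> Q" for q n
    using eps[OF that] Legendre_values[of "int n" "int q"] by auto
  have w_nonneg: "w n \<ge> 0" for n
    unfolding w_def by (intro prod_nonneg) (use factor in simp)
  have w_le: "w n \<le> 2 ^ card Q" for n
  proof -
    have "w n \<le> (\<Prod>q\<in>Q. 2)" unfolding w_def by (intro prod_mono) (use factor in simp)
    then show ?thesis by simp
  qed
  have w_expand: "w n = (\<Sum>S\<in>Pow Q. e S * legendre_char S n)" for n
  proof -
    have "w n = (\<Prod>q\<in>Q. real_of_int (\<epsilon> q * Legendre (int n) (int q)) + 1)"
      unfolding w_def by (intro prod.cong) auto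
    also have "\<dots> = (\<Sum>S\<in>Pow Q. e S * legendre_char S n)"
      by (subst prod_add[OF fin]) (simp add: e_def legendre_char_def prod.distrib)
    finally show ?thesis .
  qed
  have w_prime: "w p = 0" if p: "prime p" "p \<notin> ?G \<union> Q" for p
  proof -
    obtain q where q: "q \<in> Q" "Legendre (int p) (int q) \<noteq> \<epsilon> q" using p by blast
    have "\<not> q dvd p"
    proof
      assume "q dvd p"
      then have "q = p" using Q[OF q(1)] p(1) primes_dvd_imp_eq by blast
      with q(1) p(2) show False by blast
    qed
    then have "Legendre (int p) (int q) \<noteq> 0" by (simp add: Legendre_eq_0_iff)
    then have "1 + \<epsilon> q * Legendre (int p) (int q) = 0"
      using q eps[of q] Legendre_values[of "int p" "int q"] by auto
    then have "real_of_int (1 + \<epsilon> q * Legendre (int p) (int q)) = 0"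
      by (simp only: of_int_eq_0_iff)
    with q(1) show ?thesis unfolding w_def by (intro prod_zero[OF fin] bexI[of _ q])
  qed
  have "\<exists>C. \<forall>N. \<bar>\<Sum>n=1..N. legendre_char S n * mangoldt n / real n\<bar> \<le> C"
    if "S \<in> Pow Q - {{}}" for S
  proof -
    interpret real_character "legendre_char S" "\<Prod>S"
      using that fin Q by (intro real_character_legendre_char) (auto intro: finite_subset)
    show ?thesis using sum_mangoldt_bounded[OF L_nonzero] by metis
  qed
  then obtain C where C: "\<And>S N. S \<in> Pow Q - {{}} \<Longrightarrow>
      \<bar>\<Sum>n=1..N. legendre_char S n * mangoldt n / real n\<bar> \<le> C S" by metis
  obtain C1 where C1: "\<And>N. (\<Sum>n | n \<in> {1..N} \<and> \<not> prime n. mangoldt n / real n) \<le> C1"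
    using sum_mangoldt_nonprime_bounded by blast
  have abs_e: "\<bar>e S\<bar> = 1" if "S \<subseteq> Q" for S
    unfolding e_def abs_prod using eps that by (intro prod.neutral) fastforce
  \<comment> \<open>The primes of Q are included because \<open>w\<close> may be positive at them:
    their own factor is 1.\<close>
  define C2 where "C2 = (\<Sum>p\<in>?G \<union> Q. 2 ^ card Q * (mangoldt p / real p))"
  have bound: "ln (real N) \<le> 1 + (\<Sum>S\<in>Pow Q - {{}}. C S) + 2 ^ card Q * C1 + C2" if "N > 0" for N
  proof -
    have "(\<Sum>n=1..N. w n * (mangoldt n / real n))
        = (\<Sum>S\<in>Pow Q. e S * (\<Sum>n=1..N. legendre_char S n * mangoldt n / real n))"
      unfolding w_expand sum_distrib_right by (subst sum.swap) (simp add: sum_distrib_left mult_ac)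
    also have "\<dots> = (\<Sum>n=1..N. mangoldt n / real n)
        + (\<Sum>S\<in>Pow Q - {{}}. e S * (\<Sum>n=1..N. legendre_char S n * mangoldt n / real n))"
      using fin by (subst sum.remove[of _ "{}"]) (auto simp: e_def legendre_char_def)
    also have "\<dots> \<ge> (ln (real N) - 1) + (\<Sum>S\<in>Pow Q - {{}}. - C S)"
    proof (intro add_mono sum_mono)
      show "ln (real N) - 1 \<le> (\<Sum>n=1..N. mangoldt n / real n)"
        by (rule sum_mangoldt_div_ge[OF that])
      fix S assume S: "S \<in> Pow Q - {{}}"
      have "\<bar>e S * (\<Sum>n=1..N. legendre_char S n * mangoldt n / real n)\<bar> \<le> C S"
        using C[OF S, of N] abs_e[of S] S by (simp add: abs_mult)
      then show "- C S \<le> e S * (\<Sum>n=1..N. legendre_char S n * mangoldt n / real n)"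
        by linarith
    qed
    finally have lower: "ln (real N) \<le> 1 + (\<Sum>S\<in>Pow Q - {{}}. C S) + (\<Sum>n=1..N. w n * (mangoldt n / real n))"
      by (simp add: sum_negf)
    have "(\<Sum>n=1..N. w n * (mangoldt n / real n))
        = (\<Sum>n | n \<in> {1..N} \<and> \<not> prime n. w n * (mangoldt n / real n))
        + (\<Sum>n | n \<in> {1..N} \<and> prime n. w n * (mangoldt n / real n))"
      by (subst sum.union_disjoint[symmetric]) (auto intro!: sum.cong)
    also have "(\<Sum>n | n \<in> {1..N} \<and> \<not> prime n. w n * (mangoldt n / real n))
        \<le> (\<Sum>n | n \<in> {1..N} \<and> \<not> prime n. 2 ^ card Q * (mangoldt n / real n))"
      by (intro sum_mono mult_right_mono w_le) (simp add: mangoldt_nonneg)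
    also have "\<dots> \<le> 2 ^ card Q * C1"
      unfolding sum_distrib_left[symmetric] by (intro mult_left_mono C1) auto
    also have "(\<Sum>n | n \<in> {1..N} \<and> prime n. w n * (mangoldt n / real n))
        = (\<Sum>n | n \<in> {1..N} \<and> prime n \<and> n \<in> ?G \<union> Q. w n * (mangoldt n / real n))"
      by (rule sum.mono_neutral_right) (use w_prime in auto)
    also have "\<dots> \<le> (\<Sum>n | n \<in> {1..N} \<and> prime n \<and> n \<in> ?G \<union> Q. 2 ^ card Q * (mangoldt n / real n))"
      by (intro sum_mono mult_right_mono w_le) (simp add: mangoldt_nonneg)
    also have "\<dots> \<le> C2"
      unfolding C2_def using finG fin by (intro sum_mono2) (auto simp: mangoldt_nonneg)
    finally show ?thesis using lower by linarith
  qed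
  have "filterlim (\<lambda>N. ln (real N)) at_top sequentially"
    by (rule filterlim_compose[OF ln_at_top filterlim_real_sequentially])
  then have "\<forall>\<^sub>F N in sequentially. ln (real N) > 1 + (\<Sum>S\<in>Pow Q - {{}}. C S) + 2 ^ card Q * C1 + C2"
    unfolding filterlim_at_top_dense by blast
  with eventually_gt_at_top[of 0] have "\<forall>\<^sub>F N::nat in sequentially. False"
  proof eventually_elim
    case (elim N)
    then show ?case using bound[of N] by linarith
  qed
  then show False by simp
qed

section \<open>The Schemmel totient\<close>

text \<open>The condition depends only on k modulo n, so n may be traded for 0. The residues below n
  suit the Chinese remainder theorem and division with remainder.\<close>

lemma schemmel_altdef: "schemmel m n = card {k\<in>{..<n}. \<forall>s<m. coprime (k + s) n}"
proof (cases "n = 0")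
  case False
  define P where "P k \<longleftrightarrow> (\<forall>s<m. coprime (k + s) n)" for k
  have P: "P n \<longleftrightarrow> P 0"
    unfolding P_def coprime_iff_gcd_eq_1 by (metis add.commute add_0 gcd_add1)
  have "bij_betw (\<lambda>k. if k = n then 0 else k) {k\<in>{1..n}. P k} {k\<in>{..<n}. P k}"
    by (rule bij_betwI[where g = "\<lambda>k. if k = 0 then n else k"])
      (use False P in \<open>auto split: if_splits\<close>)
  then show ?thesis unfolding schemmel_def P_def by (rule bij_betw_same_card)
qed (simp add: schemmel_def)

lemma schemmel_1 [simp]: "schemmel m (Suc 0) = 1"
  by (simp add: schemmel_def)

lemma coprime_mod_add_iff:
  fixes k s a :: nat
  assumes "a > 0"
  shows "coprime (k mod a + s) a \<longleftrightarrow> coprime (k + s) a"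
  by (metis coprime_mod_left_iff mod_add_left_eq assms neq0_conv)

lemma schemmel_mult_coprime:
  assumes "coprime a b"
  shows "schemmel m (a * b) = schemmel m a * schemmel m b"
proof (cases "a = 0 \<or> b = 0")
  case False
  then have pos: "a > 0" "b > 0" by auto
  have "bij_betw (\<lambda>k. (k mod a, k mod b)) {k\<in>{..<a * b}. \<forall>s<m. coprime (k + s) (a * b)}
      ({k\<in>{..<a}. \<forall>s<m. coprime (k + s) a} \<times> {k\<in>{..<b}. \<forall>s<m. coprime (k + s) b})"
  proof (rule bij_betw_imageI)
    show "inj_on (\<lambda>k. (k mod a, k mod b)) {k\<in>{..<a * b}. \<forall>s<m. coprime (k + s) (a * b)}"
    proof (rule inj_onI, clarsimp)
      fix x y assume xy: "x < a * b" "y < a * b" "x mod a = y mod a" "x mod b = y mod b"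
      then have "[x = y] (mod a * b)"
        using assms by (intro coprime_cong_mult_nat) (auto simp: cong_def)
      then show "x = y" using xy by (simp add: cong_def)
    qed
    show "(\<lambda>k. (k mod a, k mod b)) ` {k\<in>{..<a * b}. \<forall>s<m. coprime (k + s) (a * b)}
        = {k\<in>{..<a}. \<forall>s<m. coprime (k + s) a} \<times> {k\<in>{..<b}. \<forall>s<m. coprime (k + s) b}"
    proof (intro equalityI subsetI)
      fix z assume "z \<in> {k\<in>{..<a}. \<forall>s<m. coprime (k + s) a} \<times> {k\<in>{..<b}. \<forall>s<m. coprime (k + s) b}"
      then obtain x y where z: "z = (x, y)" "x < a" "y < b"
        "\<forall>s<m. coprime (x + s) a" "\<forall>s<m. coprime (y + s) b" by auto
      obtain k where k: "k < a * b" "[k = x] (mod a)" "[k = y] (mod b)"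
        using binary_chinese_remainder_unique_nat[OF assms, of x y] pos by auto
      then have "k mod a = x" "k mod b = y" using z by (auto simp: cong_def)
      moreover from this have "coprime (k + s) (a * b)" if "s < m" for s
        using z(4,5) that pos coprime_mod_add_iff[of a k s] coprime_mod_add_iff[of b k s] by simp
      ultimately show "z \<in> (\<lambda>k. (k mod a, k mod b)) ` {k\<in>{..<a * b}. \<forall>s<m. coprime (k + s) (a * b)}"
        using z(1) k(1) by (intro image_eqI[of _ _ k]) auto
    qed (use pos in \<open>auto simp: coprime_mod_add_iff\<close>)
  qed
  then show ?thesis unfolding schemmel_altdef by (simp add: bij_betw_same_card card_cartesian_product)
qed (auto simp: schemmel_def)

text \<open>Only the remainder r of x modulo q matters: the m consecutive integers starting at r
  avoid the multiples of q exactly when r lies between 1 and q - m, and the quotient is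
  free.\<close>

lemma schemmel_prime_power:
  assumes "prime q" "0 < m" "m < q"
  shows "schemmel m (q ^ Suc k) = q ^ k * (q - m)"
proof -
  have q: "q > 0" using assms by simp
  have "bij_betw (\<lambda>k. (k div q, k mod q)) {x\<in>{..<q ^ Suc k}. \<forall>s<m. coprime (x + s) (q ^ Suc k)}
      ({..<q ^ k} \<times> {1..q - m})"
  proof (rule bij_betwI[where g = "\<lambda>(i, r). i * q + r"])
    have *: "(\<forall>s<m. coprime (x + s) (q ^ Suc k)) \<longleftrightarrow> x mod q \<in> {1..q - m}" for x
    proof -
      have "coprime (x + s) (q ^ Suc k) \<longleftrightarrow> \<not> q dvd x mod q + s" for s
      proof -
        have "coprime (x + s) (q ^ Suc k) \<longleftrightarrow> \<not> q dvd x + s"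
          using assms(1) by (metis coprime_commute coprime_power_left_iff not_prime_unit prime_imp_coprime
              coprime_absorb_left zero_less_Suc nat.distinct(1))
        then show ?thesis by (metis dvd_eq_mod_eq_0 mod_add_left_eq)
      qed
      moreover have "(\<forall>s<m. \<not> q dvd x mod q + s) \<longleftrightarrow> x mod q \<in> {1..q - m}"
      proof
        assume H: "\<forall>s<m. \<not> q dvd x mod q + s"
        have "x mod q \<noteq> 0" using H assms(2) by (metis add_0_right dvd_0_right)
        moreover have "x mod q \<le> q - m"
        proof (rule ccontr)
          assume "\<not> x mod q \<le> q - m"
          moreover have "x mod q < q" using q by simp
          ultimately have "q - x mod q < m" "x mod q + (q - x mod q) = q" using assms by linarith+
          with H show False by (metis dvd_refl)
        qed
        ultimately show "x mod q \<in> {1..q - m}" by simp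
      next
        assume "x mod q \<in> {1..q - m}"
        then have "0 < x mod q + s \<and> x mod q + s < q" if "s < m" for s
          using that assms by auto
        then show "\<forall>s<m. \<not> q dvd x mod q + s" by (meson nat_dvd_not_less)
      qed
      ultimately show ?thesis by simp
    qed
    show "(\<lambda>k. (k div q, k mod q)) \<in> {x\<in>{..<q ^ Suc k}. \<forall>s<m. coprime (x + s) (q ^ Suc k)}
        \<rightarrow> {..<q ^ k} \<times> {1..q - m}"
      unfolding * by (auto intro!: less_mult_imp_div_less simp: mult.commute)
    show "(\<lambda>(i, r). i * q + r) \<in> {..<q ^ k} \<times> {1..q - m}
        \<rightarrow> {x\<in>{..<q ^ Suc k}. \<forall>s<m. coprime (x + s) (q ^ Suc k)}"
      unfolding *
    proof clarsimp
      fix i r assume ir: "i < q ^ k" "Suc 0 \<le> r" "r \<le> q - m"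
      have "(i + 1) * q \<le> q ^ k * q" using ir by (intro mult_right_mono) auto
      then show "i * q + r < q * q ^ k \<and> Suc 0 \<le> r mod q \<and> r mod q \<le> q - m"
        using ir assms by (simp add: algebra_simps)
    qed
  qed (use assms in auto)
  then show ?thesis unfolding schemmel_altdef by (simp add: bij_betw_same_card card_cartesian_product)
qed

lemma schemmel_eq_prod:
  assumes "0 < m" "n > 0" "\<And>q. prime q \<Longrightarrow> q dvd n \<Longrightarrow> m < q"
  shows "real (schemmel m n) = real n * (\<Prod>q\<in>prime_factors n. 1 - real m / real q)"
  using assms(2,3)
proof (induction n rule: less_induct)
  case (less n)
  show ?case
  proof (cases "n = 1")
    case False
    then obtain p where p: "prime p" "p dvd n" using prime_factor_nat by blast
    obtain b where b: "n = p ^ multiplicity p n * b" "\<not> p dvd b"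
      using multiplicity_decompose'[of n p] less.prems p by (metis not_prime_unit not_gr_zero)
    have "multiplicity p n > 0" using p less.prems by (simp add: prime_multiplicity_gt_zero_iff)
    then obtain k where k: "multiplicity p n = Suc k" using gr0_implies_Suc by blast
    have n: "n = p ^ Suc k * b" using b k by simp
    have "b > 0" using less.prems n by (auto intro: gr0I)
    have "1 < p ^ Suc k" using p by (metis one_less_power prime_gt_1_nat zero_less_Suc)
    then have "b < n" using \<open>b > 0\<close> n by simp
    have mp: "m < p" using less.prems p by simp
    have IH: "real (schemmel m b) = real b * (\<Prod>q\<in>prime_factors b. 1 - real m / real q)"
      using less.IH[OF \<open>b < n\<close> \<open>b > 0\<close>] less.prems n by (meson dvd_triv_right dvd_trans)
    have cop: "coprime (p ^ Suc k) b"
      using p(1) b(2) by (metis coprime_power_left_iff prime_imp_coprime)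
    have pf: "prime_factors n = insert p (prime_factors b)"
      using p(1) \<open>b > 0\<close> unfolding n
      by (subst prime_factors_product) (auto simp: prime_factorization_prime_power simp del: power_Suc)
    have "real (schemmel m n) = real (p ^ k * (p - m)) * real (schemmel m b)"
      unfolding n by (simp only: schemmel_mult_coprime[OF cop] schemmel_prime_power[OF p(1) assms(1) mp] of_nat_mult)
    also have "real (p ^ k * (p - m)) = real (p ^ Suc k) * (1 - real m / real p)"
      using mp by (simp add: of_nat_diff field_simps)
    also have "\<dots> * real (schemmel m b) = real n * ((1 - real m / real p) * (\<Prod>q\<in>prime_factors b. 1 - real m / real q))"
      unfolding n IH by simp
    also have "(1 - real m / real p) * (\<Prod>q\<in>prime_factors b. 1 - real m / real q)
        = (\<Prod>q\<in>prime_factors n. 1 - real m / real q)"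
      unfolding pf using b(2) by (subst prod.insert) auto
    finally show ?thesis .
  qed simp
qed

section \<open>Lower bound for the totient of integers without small prime factors\<close>

lemma prod_prime_factors_le:
  assumes "n > (0::nat)"
  shows "\<Prod>(prime_factors n) \<le> n"
proof -
  have "\<Prod>(prime_factors n) \<le> (\<Prod>p\<in>prime_factors n. p ^ multiplicity p n)"
    by (intro prod_mono) (auto intro!: self_le_power simp: prime_factors_multiplicity prime_ge_1_nat Suc_le_eq prime_gt_0_nat)
  also have "\<dots> = n" using assms by (rule prime_factorization_nat[symmetric])
  finally show ?thesis .
qed

text \<open>Compare the product of the 1 - m / q with that of the q^(-\<delta>). Each quotient of
  factors is at least 1 for q \<ge> K and at least 1 / (m + 1) for the at most K smaller primes; the
  product of the primes q dividing n is at most n.\<close>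

lemma schemmel_lower_bound:
  fixes \<delta> :: real
  assumes "0 < m" "0 < \<delta>"
  obtains c where "c > 0"
    and "\<And>n. n > 0 \<Longrightarrow> (\<And>q. prime q \<Longrightarrow> q dvd n \<Longrightarrow> m < q) \<Longrightarrow>
      real (schemmel m n) \<ge> c * real n powr (1 - \<delta>)"
proof -
  \<comment> \<open>From this threshold on q^\<delta> is at least m + 1, which makes up for 1 - m /
    q \<ge> 1 / (m + 1).\<close>
  define K where "K = nat \<lceil>(real m + 1) powr (1 / \<delta>)\<rceil>"
  define c where "c = (1 / (real m + 1)) ^ K"
  have "c > 0" by (simp add: c_def)
  moreover have "real (schemmel m n) \<ge> c * real n powr (1 - \<delta>)"
    if n: "n > 0" "\<And>q. prime q \<Longrightarrow> q dvd n \<Longrightarrow> m < q" for n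
  proof -
    let ?P = "prime_factors n"
    have m1: "1 - real m / real q \<ge> 1 / (real m + 1)" if "q \<in> ?P" for q
    proof -
      have "m + 1 \<le> q" using n that by (auto simp: prime_factors_dvd Suc_le_eq)
      then have "real m + 1 \<le> real q" by linarith
      then have "real m / real q \<le> real m / (real m + 1)" by (intro divide_left_mono) auto
      then show ?thesis by (simp add: field_simps)
    qed
    have m0: "1 - real m / real q \<ge> 0" if "q \<in> ?P" for q
      by (rule order_trans[OF _ m1[OF that]]) simp
    have factor: "(if q < K then 1 / (real m + 1) else 1) \<le> (1 - real m / real q) * real q powr \<delta>"
      if q: "q \<in> ?P" for q
    proof (cases "q < K")
      case True
      have "real q powr \<delta> \<ge> 1" using q assms(2) prime_ge_1_nat[of q]
        by (intro ge_one_powr_ge_zero) (auto simp: prime_factors_dvd)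
      then have "1 / (real m + 1) * 1 \<le> (1 - real m / real q) * real q powr \<delta>"
        using m1[OF q] by (intro mult_mono) (use m0[OF q] in auto)
      with True show ?thesis by simp
    next
      case False
      have "(real m + 1) powr (1 / \<delta>) \<le> real q" using False by (simp add: K_def not_less nat_le_iff ceiling_le_iff)
      then have "((real m + 1) powr (1 / \<delta>)) powr \<delta> \<le> real q powr \<delta>"
        using assms(2) by (intro powr_mono2) auto
      then have "real m + 1 \<le> real q powr \<delta>" using assms(2) by (simp add: powr_powr)
      then have "1 / (real m + 1) * (real m + 1) \<le> (1 - real m / real q) * real q powr \<delta>"
        using m1[OF q] by (intro mult_mono) (use m0[OF q] in auto)
      with False show ?thesis by simp
    qed
    have "c \<le> (1 / (real m + 1)) ^ card (?P \<inter> {..<K})"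
      unfolding c_def using card_mono[of "{..<K}" "?P \<inter> {..<K}"] by (intro power_decreasing) auto
    also have "\<dots> = (\<Prod>q\<in>?P. if q < K then 1 / (real m + 1) else 1)"
      by (simp add: prod.If_cases lessThan_def Int_commute)
    also have "\<dots> \<le> (\<Prod>q\<in>?P. (1 - real m / real q) * real q powr \<delta>)"
      by (intro prod_mono conjI factor) auto
    also have "\<dots> = (\<Prod>q\<in>?P. 1 - real m / real q) * real (\<Prod>?P) powr \<delta>"
      by (simp add: prod.distrib prod_powr_distrib)
    also have "\<dots> \<le> (\<Prod>q\<in>?P. 1 - real m / real q) * real n powr \<delta>"
    proof (intro mult_left_mono powr_mono2)
      show "real (\<Prod>?P) \<le> real n" using prod_prime_factors_le[OF n(1)] by (simp only: of_nat_le_iff)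
      show "(\<Prod>q\<in>?P. 1 - real m / real q) \<ge> 0"
        by (intro prod_nonneg m0)
      show "0 \<le> real (\<Prod>?P)" by (rule of_nat_0_le_iff)
      show "0 \<le> \<delta>" using assms(2) by simp
    qed
    finally have "c * real n powr (1 - \<delta>) \<le> (\<Prod>q\<in>?P. 1 - real m / real q) * real n powr \<delta> * real n powr (1 - \<delta>)"
      by (rule mult_right_mono) simp
    also have "\<dots> = real (schemmel m n)"
    proof -
      have "real n powr \<delta> * real n powr (1 - \<delta>) = real n"
        using n(1) by (simp add: powr_add[symmetric])
      then show ?thesis by (simp only: schemmel_eq_prod[OF assms(1) n] mult.assoc) (simp only: mult.commute)
    qed
    finally show ?thesis .
  qed
  ultimately show thesis by (rule that)
qed

section \<open>Primes p with p - m free of small prime factors\<close>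

text \<open>If q in \<open>Q\<close> divided p - m, then p and m would have equal Legendre symbols,
  whereas the prescribed ones are opposite and nonzero. A prime dividing both m and p - m would
  divide p, hence equal p, which exceeds m.\<close>

lemma infinite_primes_shift_coprime:
  fixes m :: nat
  assumes "even m"
  shows "infinite {p. prime p \<and> m < p \<and> (\<forall>q. prime q \<longrightarrow> q dvd p - m \<longrightarrow> m < q)}"
proof -
  \<comment> \<open>As m is even, every prime up to m outside this set, 2 included, divides
    m.\<close>
  define Q where "Q = {q. prime q \<and> 2 < q \<and> q \<le> m \<and> \<not> q dvd m}"
  have Q: "finite Q" unfolding Q_def by (rule finite_subset[of _ "{..m}"]) auto
  define \<epsilon> where "\<epsilon> q = - Legendre (int m) (int q)" for q
  have "\<epsilon> q \<in> {-1, 1}" if "q \<in> Q" for q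
    using that Legendre_values[of "int m" "int q"] Legendre_eq_0_iff[of m q] by (auto simp: \<epsilon>_def Q_def)
  then have "infinite {p. prime p \<and> (\<forall>q\<in>Q. Legendre (int p) (int q) = \<epsilon> q)}"
    using Q by (intro infinite_primes_prescribed_Legendre) (auto simp: Q_def)
  \<comment> \<open>Removing the primes up to m makes \<open>p - m\<close> a genuine, positive
    difference.\<close>
  then have "infinite ({p. prime p \<and> (\<forall>q\<in>Q. Legendre (int p) (int q) = \<epsilon> q)} - {..m})"
    by (rule Diff_infinite_finite[rotated]) simp
  then show ?thesis
  proof (rule infinite_super[rotated], safe)
    fix p assume p: "prime p" "\<forall>q\<in>Q. Legendre (int p) (int q) = \<epsilon> q" "\<not> p \<le> m"
    then show "m < p" by simp
    fix q assume q: "prime q" "q dvd p - m"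
    show "m < q"
    proof (rule ccontr)
      assume "\<not> m < q"
      then have "q \<le> m" by simp
      have "\<not> q dvd m"
      proof
        assume "q dvd m"
        with q p have "q dvd p" by (metis dvd_diffD nat_le_linear)
        with q p have "q = p" by (simp add: primes_dvd_imp_eq)
        with \<open>q \<le> m\<close> p show False by simp
      qed
      moreover from this have "q \<noteq> 2" using assms by auto
      ultimately have "q \<in> Q" using q \<open>q \<le> m\<close> prime_ge_2_nat[of q] by (simp add: Q_def)
      have "int q dvd int p - int m" using q p by (metis of_nat_diff int_dvd_int_iff nat_le_linear)
      then have "Legendre (int p) (int q) = Legendre (int m) (int q)"
        by (intro Legendre_cong) (simp add: cong_iff_dvd_diff)
      with p \<open>q \<in> Q\<close> have "Legendre (int m) (int q) = 0" by (simp add: \<epsilon>_def)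
      with \<open>\<not> q dvd m\<close> show False by (simp add: Legendre_eq_0_iff)
    qed
  qed
qed

section \<open>The inequality at prime powers\<close>

lemma schemmel_iterate_prime_power:
  assumes "prime p" "0 < m" "m < p"
  shows "(schemmel m ^^ 2) (p ^ Suc k) = schemmel m (p ^ k) * schemmel m (p - m)"
proof -
  have "\<not> p dvd p - m" using assms by (auto dest: dvd_imp_le)
  then have "coprime (p ^ k) (p - m)"
    using assms(1) by (metis coprime_power_left_iff prime_imp_coprime)
  then show ?thesis
    using schemmel_prime_power[OF assms, of k] by (simp add: numeral_2_eq_2 schemmel_mult_coprime)
qed

text \<open>Factor out \<open>p ^ k\<close> with k = \<alpha> - 1. For k = 0 the iterate is
  \<open>l\<close> itself, since the totient of 1 is 1. For k > 0 it carries the additional factor 1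
  - m / p, which is at least 1/2 as 2 m < p; this explains the factors 2 in the hypothesis on
  \<open>schemmel m (p - m)\<close>.\<close>

lemma schemmel_sum_gt:
  fixes A \<delta> :: real
  assumes "prime p" "0 < m" "2 * m < p" "A > 0" "\<alpha> > 0"
    and L: "real (schemmel m (p - m)) > 2 * real m + 2 * A * real p powr (1 - \<delta>)"
  shows "real (schemmel m (p ^ \<alpha>)) + real ((schemmel m ^^ 2) (p ^ \<alpha>))
      > real p ^ \<alpha> + A * real p powr (real \<alpha> - \<delta>)"
proof -
  obtain k where k: "\<alpha> = Suc k" using assms(5) gr0_implies_Suc by blast
  define l where "l = real (schemmel m (p - m))"
  define X where "X = A * real p powr (1 - \<delta>)"
  have mp: "m < p" and p: "real p > 0" using assms by auto
  have "X > 0" using assms p by (simp add: X_def)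
  have pow: "A * real p powr (real \<alpha> - \<delta>) = real p ^ k * X"
    using p by (simp add: k X_def powr_realpow[symmetric] powr_add[symmetric] algebra_simps)
  have first: "real (schemmel m (p ^ \<alpha>)) = real p ^ k * (real p - real m)"
    unfolding k schemmel_prime_power[OF assms(1,2) mp] using mp by (simp add: of_nat_diff)
  have second: "real ((schemmel m ^^ 2) (p ^ \<alpha>)) = real (schemmel m (p ^ k)) * l"
    unfolding k schemmel_iterate_prime_power[OF assms(1,2) mp] by (simp add: l_def)
  show ?thesis
  proof (cases k)
    case 0
    have "real p - real m + l > real p + X"
      using L \<open>X > 0\<close> unfolding l_def[symmetric] X_def[symmetric] mult.assoc by simp
    then show ?thesis unfolding pow first second using 0 by (simp add: k)
  next
    case (Suc j)
    have sk: "real (schemmel m (p ^ k)) = real p ^ j * (real p - real m)"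
      unfolding Suc schemmel_prime_power[OF assms(1,2) mp] using mp by (simp add: of_nat_diff)
    have "real p * (real p - real m) + (real p - real m) * l > real p * real p + real p * X"
    proof -
      have "real p / 2 * l \<le> (real p - real m) * l"
        using assms(3) by (intro mult_right_mono) (auto simp: l_def)
      moreover have "real p / 2 * (2 * real m + 2 * X) < real p / 2 * l"
        using L p unfolding l_def X_def by (intro mult_strict_left_mono) auto
      ultimately show ?thesis by (simp add: algebra_simps)
    qed
    then have "real p ^ j * (real p * (real p - real m) + (real p - real m) * l)
        > real p ^ j * (real p * real p + real p * X)"
      using p by (intro mult_strict_left_mono) auto
    then show ?thesis
      unfolding pow first second sk by (simp add: k Suc algebra_simps)
  qed
qed

text \<open>After division by x^(1 - \<delta>') both terms of the smaller side tend to 0. The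
  argument x / 2 stands for the lower bound p / 2 of p - m.\<close>

lemma eventually_powr_bound:
  fixes A c \<delta> \<delta>' M :: real
  assumes "c > 0" "0 < \<delta>'" "\<delta>' < \<delta>" "\<delta>' < 1"
  shows "\<forall>\<^sub>F x in at_top. c * (x / 2) powr (1 - \<delta>') > M + A * x powr (1 - \<delta>)"
proof -
  have "((\<lambda>x. M * x powr (\<delta>' - 1) + A * x powr (\<delta>' - \<delta>)) \<longlongrightarrow> M * 0 + A * 0) at_top"
    by (intro tendsto_intros tendsto_neg_powr filterlim_ident) (use assms in auto)
  then have "\<forall>\<^sub>F x in at_top. M * x powr (\<delta>' - 1) + A * x powr (\<delta>' - \<delta>) < c * (1 / 2) powr (1 - \<delta>')"
    by (rule order_tendstoD) (use assms(1) in simp)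
  then show ?thesis using eventually_gt_at_top[of 0]
  proof eventually_elim
    case (elim x)
    have "M + A * x powr (1 - \<delta>) = (M * x powr (\<delta>' - 1) + A * x powr (\<delta>' - \<delta>)) * x powr (1 - \<delta>')"
      using elim(2) by (simp add: distrib_right mult.assoc powr_add[symmetric])
    also have "\<dots> < c * (1 / 2) powr (1 - \<delta>') * x powr (1 - \<delta>')"
      using elim by (intro mult_strict_right_mono) auto
    also have "\<dots> = c * (x / 2) powr (1 - \<delta>')"
      using elim(2) by (simp add: powr_mult[symmetric])
    finally show ?case .
  qed
qed

theorem theorem2p5:
  fixes m :: nat and A \<delta> :: real
  assumes "m > 0" and "even m" and "A > 0" and "\<delta> > 0"
  shows "infinite {p::nat. prime p \<and> (\<forall>\<alpha>::nat. \<alpha> > 0 \<longrightarrow>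
    real (schemmel m (p ^ \<alpha>)) + real ((schemmel m ^^ 2) (p ^ \<alpha>))
      > real p ^ \<alpha> + A * real p powr (real \<alpha> - \<delta>))}"
proof -
  \<comment> \<open>Strictly below both \<delta> and 1, so that p^(1 - \<delta>') outgrows both p^(1
    - \<delta>) and constants.\<close>
  define \<delta>' where "\<delta>' = min \<delta> 1 / 2"
  have \<delta>': "0 < \<delta>'" "\<delta>' < \<delta>" "\<delta>' < 1" using assms(4) by (auto simp: \<delta>'_def)
  obtain c where c: "c > 0" and lower: "\<And>n. n > 0 \<Longrightarrow> (\<And>q. prime q \<Longrightarrow> q dvd n \<Longrightarrow> m < q) \<Longrightarrow>
      real (schemmel m n) \<ge> c * real n powr (1 - \<delta>')"
    using schemmel_lower_bound[OF assms(1) \<delta>'(1)] by blast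
  have "\<forall>\<^sub>F p::nat in sequentially. c * (real p / 2) powr (1 - \<delta>') > 2 * real m + 2 * A * real p powr (1 - \<delta>)"
    using eventually_compose_filterlim[OF eventually_powr_bound[OF c \<delta>'] filterlim_real_sequentially] .
  then obtain N where N: "\<And>p::nat. p \<ge> N \<Longrightarrow>
      c * (real p / 2) powr (1 - \<delta>') > 2 * real m + 2 * A * real p powr (1 - \<delta>)"
    unfolding eventually_at_top_linorder by blast
  \<comment> \<open>Primes up to N are dropped for the growth estimate, and those up to 2 m to
    ensure p - m \<ge> p / 2.\<close>
  have "infinite ({p. prime p \<and> m < p \<and> (\<forall>q. prime q \<longrightarrow> q dvd p - m \<longrightarrow> m < q)} - {..max N (2 * m)})"
    by (intro Diff_infinite_finite infinite_primes_shift_coprime assms) simp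
  then show ?thesis
  proof (rule infinite_super[rotated], safe)
    fix p \<alpha> :: nat
    assume p: "prime p" "m < p" "\<forall>q. prime q \<longrightarrow> q dvd p - m \<longrightarrow> m < q" "\<not> p \<le> max N (2 * m)"
      and "\<alpha> > 0"
    have "(real p / 2) powr (1 - \<delta>') \<le> real (p - m) powr (1 - \<delta>')"
      using p \<delta>' by (intro powr_mono2) (auto simp: of_nat_diff)
    then have "c * (real p / 2) powr (1 - \<delta>') \<le> c * real (p - m) powr (1 - \<delta>')"
      using c by simp
    also have "\<dots> \<le> real (schemmel m (p - m))"
      using p by (intro lower) auto
    finally have "c * (real p / 2) powr (1 - \<delta>') \<le> real (schemmel m (p - m))" .
    moreover have "2 * real m + 2 * A * real p powr (1 - \<delta>) < c * (real p / 2) powr (1 - \<delta>')"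
      using p(4) by (intro N) simp
    ultimately have "real (schemmel m (p - m)) > 2 * real m + 2 * A * real p powr (1 - \<delta>)"
      by linarith
    then show "real (schemmel m (p ^ \<alpha>)) + real ((schemmel m ^^ 2) (p ^ \<alpha>))
        > real p ^ \<alpha> + A * real p powr (real \<alpha> - \<delta>)"
      using p assms \<open>\<alpha> > 0\<close> by (intro schemmel_sum_gt) auto
  qed
qed

end
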